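(* Let $m_1,m_2\in\mathbb{R}$, $\sigma_1,\sigma_2>0$, $\theta\in(-1,1)$, and suppose $(X,Y)$ is bivariate normal with means $m_1,m_2$, variances $\sigma_1^2,\sigma_2^2$ and correlation $\theta$. Let $(X_1,Y_1),(X_2,Y_2),(X_3,Y_3)$ be i.i.d. copies of $(X,Y)$, and let $\kappa(\theta)=\kappa(X,Y)$ be Bergsma's covariance. Then: (i) $\mu_1:=\mathbb{E}|X_1-X_2|=\dfrac{2\sigma_1}{\sqrt\pi}$; (ii) $\mu_2:=\mathbb{E}|Y_1-Y_2|=\dfrac{2\sigma_2}{\sqrt\pi}$; (iii) $\mu_3:=\mathbb{E}\big[|X_1-X_2|\,|Y_1-Y_3|\big]=\sigma_1\sigma_2\left[\dfrac{2}{\pi}\sqrt{\dfrac{1}{4-\theta^2}}+\dfrac{2\theta}{\pi}\sin^{-1}\!\Big(\dfrac{\theta}{2}\Big)+\dfrac{2(3-\theta^2)}{\pi\sqrt{4-\theta^2}}\right]$; (iv) $\mu_{12}:=\mathbb{E}\big[|X_1-X_2|\,|Y_1-Y_2|\big]=\dfrac{4\sigma_1\sigma_2}{\pi}\big(\theta\sin^{-1}\theta+\sqrt{1-\theta^2}\big)$; (v) $\kappa(\theta)=\dfrac14\big[\mu_{12}+\mu_1\mu_2-2\mu_3\big]$; (vi) $\kappa(\theta)=\dfrac{\sigma_1\sigma_2}{\pi}\left[\theta\sin^{-1}\theta+\sqrt{1-\theta^2}+1-\theta\sin^{-1}\!\Big(\dfrac{\theta}{2}\Big)-\sqrt{4-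\theta^2}\right]$.
   Context: For a distribution function $F$ on $\mathbb{R}$ with finite mean, with $Z_1,Z_2$ i.i.d. $F$, define $h_F(z_1,z_2)=-\tfrac12\,\mathbb{E}\big(|z_1-z_2|-|z_1-Z_2|-|Z_1-z_2|+|Z_1-Z_2|\big)$. For a bivariate random variable $(X,Y)$ with marginal distribution functions $F_1,F_2$ of finite variance, Bergsma's covariance is $\kappa(X,Y)=\mathbb{E}[h_{F_1}(X_1,X_2)\,h_{F_2}(Y_1,Y_2)]$, where $(X_1,Y_1),(X_2,Y_2)$ are i.i.d. copies of $(X,Y)$. *)

theory Defs
  imports "HOL-Probability.Probability"
begin

text \<open>The law of \<open>Z\<^sub>1\<close> and \<open>Z\<^sub>2\<close> is recovered from the distribution function \<open>F\<close>
  as its Lebesgue-Stieltjes measure.\<close>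

definition bergsma_h :: "(real \<Rightarrow> real) \<Rightarrow> real \<Rightarrow> real \<Rightarrow> real" where
  "bergsma_h F z1 z2 = - (1 / 2) *
     (\<integral>(Z1, Z2). (\<bar>z1 - z2\<bar> - \<bar>z1 - Z2\<bar> - \<bar>Z1 - z2\<bar> + \<bar>Z1 - Z2\<bar>)
        \<partial>(interval_measure F \<Otimes>\<^sub>M interval_measure F))"

text \<open>The i.i.d. copies \<open>(X\<^sub>1, Y\<^sub>1)\<close>, \<open>(X\<^sub>2, Y\<^sub>2)\<close> of \<open>(X, Y)\<close> are realised as the
  coordinates of the product of the joint law with itself; lemma \<open>bergsma_cov_copies\<close> below shows that
  any other copies give the same value.\<close>

definition bergsma_cov :: "'a measure \<Rightarrow> ('a \<Rightarrow> real) \<Rightarrow> ('a \<Rightarrow> real) \<Rightarrow> real" where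
  "bergsma_cov N X Y =
     (let F1 = cdf (distr N borel X);
          F2 = cdf (distr N borel Y);
          P = distr N (borel \<Otimes>\<^sub>M borel) (\<lambda>\<omega>. (X \<omega>, Y \<omega>))
      in \<integral>((x1, y1), (x2, y2)). bergsma_h F1 x1 x2 * bergsma_h F2 y1 y2 \<partial>(P \<Otimes>\<^sub>M P))"

definition iid_copies ::
  "'a measure \<Rightarrow> ('a \<Rightarrow> real) \<Rightarrow> ('a \<Rightarrow> real) \<Rightarrow>
   'b measure \<Rightarrow> ('i \<Rightarrow> 'b \<Rightarrow> real) \<Rightarrow> ('i \<Rightarrow> 'b \<Rightarrow> real) \<Rightarrow> 'i set \<Rightarrow> bool" where
  "iid_copies N X Y M X' Y' I \<longleftrightarrow>
     prob_space.indep_vars M (\<lambda>_. borel \<Otimes>\<^sub>M borel) (\<lambda>i \<omega>. (X' i \<omega>, Y' i \<omega>)) I \<and>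
     (\<forall>i\<in>I. distr M (borel \<Otimes>\<^sub>M borel) (\<lambda>\<omega>. (X' i \<omega>, Y' i \<omega>)) =
            distr N (borel \<Otimes>\<^sub>M borel) (\<lambda>\<omega>. (X \<omega>, Y \<omega>)))"

text \<open>The parameters \<open>s1\<close> and \<open>s2\<close> are standard deviations, and \<open>\<theta>\<close> is the
  correlation; the formula is meant for \<open>s1, s2 > 0\<close> and \<open>\<bar>\<theta>\<bar> < 1\<close>.\<close>

definition bivariate_normal_density ::
  "real \<Rightarrow> real \<Rightarrow> real \<Rightarrow> real \<Rightarrow> real \<Rightarrow> real \<times> real \<Rightarrow> real" where
  "bivariate_normal_density m1 m2 s1 s2 \<theta> = (\<lambda>(x, y).
     1 / (2 * pi * s1 * s2 * sqrt (1 - \<theta>\<^sup>2)) *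
     exp (- 1 / (2 * (1 - \<theta>\<^sup>2)) *
       ((x - m1)\<^sup>2 / s1\<^sup>2 - 2 * \<theta> * (x - m1) * (y - m2) / (s1 * s2) + (y - m2)\<^sup>2 / s2\<^sup>2)))"

definition bivariate_normal ::
  "'a measure \<Rightarrow> ('a \<Rightarrow> real) \<Rightarrow> ('a \<Rightarrow> real) \<Rightarrow> real \<Rightarrow> real \<Rightarrow> real \<Rightarrow> real \<Rightarrow> real \<Rightarrow> bool" where
  "bivariate_normal N X Y m1 m2 s1 s2 \<theta> \<longleftrightarrow>
     distributed N (lborel \<Otimes>\<^sub>M lborel) (\<lambda>\<omega>. (X \<omega>, Y \<omega>))
       (\<lambda>p. ennreal (bivariate_normal_density m1 m2 s1 s2 \<theta> p))"

lemma interval_measure_cdf: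
  assumes "real_distribution D"
  shows "interval_measure (cdf D) = D"
proof -
  interpret real_distribution D by fact
  show ?thesis
    by (intro cdf_unique real_distribution_interval_measure cdf_interval_measure assms
        cdf_nondecreasing cdf_is_right_cont cdf_lim_at_top_prob cdf_lim_at_bot)
qed

lemma bergsma_h_measurable:
  assumes "real_distribution D"
  shows "(\<lambda>(z1, z2). bergsma_h (cdf D) z1 z2) \<in> borel_measurable (borel \<Otimes>\<^sub>M borel)"
proof -
  interpret real_distribution D by fact
  interpret P: pair_prob_space D D ..
  show ?thesis
    unfolding bergsma_h_def interval_measure_cdf[OF assms] case_prod_unfold
    by measurable
qed

lemma bergsma_cov_copies:
  assumes N: "prob_space N" and M: "prob_space M"
    and X: "X \<in> borel_measurable N" and Y: "Y \<in> borel_measurable N"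
    and copies: "iid_copies N X Y M X' Y' I" and ij: "i \<in> I" "j \<in> I" "i \<noteq> j"
  shows "bergsma_cov N X Y =
    (\<integral>\<omega>. bergsma_h (cdf (distr N borel X)) (X' i \<omega>) (X' j \<omega>) *
         bergsma_h (cdf (distr N borel Y)) (Y' i \<omega>) (Y' j \<omega>) \<partial>M)"
proof -
  interpret N: prob_space N by fact
  interpret M: prob_space M by fact
  let ?B = "borel \<Otimes>\<^sub>M borel :: (real \<times> real) measure"
  let ?P = "distr N ?B (\<lambda>\<omega>. (X \<omega>, Y \<omega>))"
  let ?Z = "\<lambda>i \<omega>. (X' i \<omega>, Y' i \<omega>)"
  have rdX: "real_distribution (distr N borel X)" and rdY: "real_distribution (distr N borel Y)"
    using X Y by (auto intro: N.real_distribution_distr)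
  note [measurable] = bergsma_h_measurable[OF rdX] bergsma_h_measurable[OF rdY]
  have ind: "M.indep_vars (\<lambda>_. ?B) ?Z I"
    and laws: "distr M ?B (?Z i) = ?P" "distr M ?B (?Z j) = ?P"
    using copies ij unfolding iid_copies_def by auto
  have "M.indep_var ?B ((\<lambda>f. f i) \<circ> (\<lambda>\<omega>. restrict (\<lambda>k. ?Z k \<omega>) {i}))
                    ?B ((\<lambda>f. f j) \<circ> (\<lambda>\<omega>. restrict (\<lambda>k. ?Z k \<omega>) {j}))"
    using ij by (intro M.indep_var_compose[OF M.indep_var_restrict[OF ind]]) auto
  then have "M.indep_var ?B (?Z i) ?B (?Z j)"
    by (simp add: comp_def)
  then have [measurable]: "?Z i \<in> measurable M ?B" "?Z j \<in> measurable M ?B"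
    and prod: "?P \<Otimes>\<^sub>M ?P = distr M (?B \<Otimes>\<^sub>M ?B) (\<lambda>\<omega>. (?Z i \<omega>, ?Z j \<omega>))"
    unfolding M.indep_var_distribution_eq laws by auto
  let ?h1 = "bergsma_h (cdf (distr N borel X))" and ?h2 = "bergsma_h (cdf (distr N borel Y))"
  have m1: "(\<lambda>p. ?h1 (fst (fst p)) (fst (snd p))) \<in> borel_measurable (?B \<Otimes>\<^sub>M ?B)"
    using measurable_compose[OF _ bergsma_h_measurable[OF rdX],
        of "\<lambda>p. (fst (fst p), fst (snd p))" "?B \<Otimes>\<^sub>M ?B"] by simp
  have m2: "(\<lambda>p. ?h2 (snd (fst p)) (snd (snd p))) \<in> borel_measurable (?B \<Otimes>\<^sub>M ?B)"
    using measurable_compose[OF _ bergsma_h_measurable[OF rdY],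
        of "\<lambda>p. (snd (fst p), snd (snd p))" "?B \<Otimes>\<^sub>M ?B"] by simp
  show ?thesis
    unfolding bergsma_cov_def Let_def prod case_prod_unfold
    by (subst integral_distr) (auto intro!: borel_measurable_times m1 m2)
qed

end

theory Submission
  imports Defs "HOL-Real_Asymp.Real_Asymp"
begin

text \<open>
  Bergsma's covariance is an expectation of a product of doubly centred kernels. A doubly centred
  kernel integrates to zero in each of its two arguments, so it is orthogonal to every function of
  one argument. Hence one of the two centrings can be dropped, and expanding the other one leaves
  \<open>\<kappa> = (\<mu>\<^sub>1\<^sub>2 + \<mu>\<^sub>1 \<mu>\<^sub>2 - 2 \<mu>\<^sub>3) / 4\<close>. This identity holds for every pair of square-integrable variables
  (\<open>bergsma_cov_iid_copies\<close>, resting on \<open>double_centred_product\<close>). The mixed moment \<open>\<mu>\<^sub>3\<close> appears because,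
  given the first copy, the differences \<open>X\<^sub>1 - X\<^sub>2\<close> and \<open>Y\<^sub>1 - Y\<^sub>3\<close> are independent, so that \<open>\<mu>\<^sub>3\<close> is the
  expected product of the two row means.

  For the normal law write \<open>X = m\<^sub>1 + \<sigma>\<^sub>1 U\<close> and \<open>Y = m\<^sub>2 + \<sigma>\<^sub>2 (\<theta> U + c V)\<close> with \<open>U, V\<close> independent standard
  normal and \<open>c = sqrt (1 - \<theta>\<^sup>2)\<close>. Invariance of the standard normal law in the plane under rotations
  (\<open>std_normal_rotate\<close>) then turns both \<open>\<mu>\<^sub>1\<^sub>2\<close> and \<open>\<mu>\<^sub>3\<close> into a multiple of one moment
  \<open>E (\<bar>A\<bar> \<bar>\<rho> A + sqrt (1 - \<rho>\<^sup>2) B\<bar>)\<close> with \<open>A, B\<close> independent standard normal: the correlation \<open>\<rho>\<close> of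
  \<open>X\<^sub>1 - X\<^sub>2\<close> with \<open>Y\<^sub>1 - Y\<^sub>2\<close> is \<open>\<theta>\<close>, and with \<open>Y\<^sub>1 - Y\<^sub>3\<close> it is \<open>\<theta> / 2\<close>, since only the first copy is shared.

  That moment is \<open>2 / \<pi> (\<rho> arcsin \<rho> + sqrt (1 - \<rho>\<^sup>2))\<close> (\<open>std_normal_abs_product_moment\<close>). With the slope
  \<open>t = B / A\<close> as a new variable, the integral over \<open>A\<close> is a third absolute moment of a centred normal
  law, and what remains is the integral of \<open>\<bar>\<rho> + sqrt (1 - \<rho>\<^sup>2) t\<bar> / (1 + t\<^sup>2)\<^sup>2\<close> over the line, which has
  an elementary antiderivative on either side of the zero of the numerator.

  The Gaussian computations use nonnegative integrals, for which substitution and Fubini's theorem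
  need only measurability.
\<close>

section \<open>Square-integrable functions\<close>

definition square_integrable :: "'a measure \<Rightarrow> ('a \<Rightarrow> real) \<Rightarrow> bool" where
  "square_integrable M f \<longleftrightarrow> f \<in> borel_measurable M \<and> integrable M (\<lambda>x. (f x)\<^sup>2)"

lemma square_integrable_mult:
  assumes "square_integrable M f" "square_integrable M g"
  shows "integrable M (\<lambda>x. f x * g x)"
proof (rule Bochner_Integration.integrable_bound)
  show "integrable M (\<lambda>x. (f x)\<^sup>2 + (g x)\<^sup>2)"
    using assms by (auto simp: square_integrable_def)
  show "(\<lambda>x. f x * g x) \<in> borel_measurable M"
    using assms by (auto simp: square_integrable_def)
  have "\<bar>a * b\<bar> \<le> a\<^sup>2 + b\<^sup>2" for a b :: real
  proof -
    have "0 \<le> (\<bar>a\<bar> - \<bar>b\<bar>)\<^sup>2" "0 \<le> \<bar>a\<bar> * \<bar>b\<bar>" by simp_all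
    moreover have "(\<bar>a\<bar> - \<bar>b\<bar>)\<^sup>2 = a\<^sup>2 + b\<^sup>2 - 2 * (\<bar>a\<bar> * \<bar>b\<bar>)"
      by (simp add: power2_diff)
    ultimately show ?thesis unfolding abs_mult by linarith
  qed
  then show "AE x in M. norm (f x * g x) \<le> norm ((f x)\<^sup>2 + (g x)\<^sup>2)"
    by simp
qed

lemma square_integrable_add:
  assumes f: "square_integrable M f" and g: "square_integrable M g"
  shows "square_integrable M (\<lambda>x. f x + g x)"
  using square_integrable_mult[OF f g] f g
  by (auto simp: square_integrable_def power2_sum mult.assoc)

lemma square_integrable_cmult:
  assumes "square_integrable M f"
  shows "square_integrable M (\<lambda>x. c * f x)"
  using assms by (auto simp: square_integrable_def power_mult_distrib)

lemma square_integrable_minus: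
  assumes "square_integrable M f"
  shows "square_integrable M (\<lambda>x. - f x)"
  using assms by (auto simp: square_integrable_def)

lemma square_integrable_diff:
  assumes "square_integrable M f" "square_integrable M g"
  shows "square_integrable M (\<lambda>x. f x - g x)"
  using square_integrable_add[OF assms(1) square_integrable_minus[OF assms(2)]] by simp

lemma square_integrable_abs:
  assumes "square_integrable M f"
  shows "square_integrable M (\<lambda>x. \<bar>f x\<bar>)"
  using assms by (auto simp: square_integrable_def)

context prob_space
begin

lemma square_integrable_const: "square_integrable M (\<lambda>_. c)"
  by (simp add: square_integrable_def)

lemma square_integrable_integrable:
  "square_integrable M f \<Longrightarrow> integrable M f"
  using square_integrable_mult[OF _ square_integrable_const[of 1]] by simp

lemma expectation_square_le:
  assumes f: "square_integrable M f"
  shows "(expectation f)\<^sup>2 \<le> expectation (\<lambda>x. (f x)\<^sup>2)"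
proof -
  have "0 \<le> expectation (\<lambda>x. (f x)\<^sup>2) - (expectation f)\<^sup>2"
    using variance_eq[of f] variance_positive[of f] square_integrable_integrable[OF f] f
    unfolding square_integrable_def by metis
  then show ?thesis by simp
qed

lemma square_integrable_fst:
  assumes "square_integrable M f"
  shows "square_integrable (M \<Otimes>\<^sub>M M) (\<lambda>z. f (fst z))"
proof -
  interpret Q: pair_prob_space M M ..
  have [measurable]: "f \<in> borel_measurable M" and "integrable M (\<lambda>x. (f x)\<^sup>2)"
    using assms by (auto simp: square_integrable_def)
  then have "integrable (M \<Otimes>\<^sub>M M) (\<lambda>z. (f (fst z))\<^sup>2)"
    by (intro Q.Fubini_integrable) (auto simp: prob_space)
  then show ?thesis
    by (simp add: square_integrable_def)
qed

lemma square_integrable_swap: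
  assumes "square_integrable (M \<Otimes>\<^sub>M M) f"
  shows "square_integrable (M \<Otimes>\<^sub>M M) (\<lambda>z. f (snd z, fst z))"
proof -
  interpret Q: pair_prob_space M M ..
  have [measurable]: "f \<in> borel_measurable (M \<Otimes>\<^sub>M M)" and *: "integrable (M \<Otimes>\<^sub>M M) (\<lambda>x. (f x)\<^sup>2)"
    using assms by (auto simp: square_integrable_def)
  show ?thesis
    using Q.integrable_product_swap[OF *] by (auto simp: square_integrable_def case_prod_unfold)
qed

lemma square_integrable_snd:
  "square_integrable M f \<Longrightarrow> square_integrable (M \<Otimes>\<^sub>M M) (\<lambda>z. f (snd z))"
  using square_integrable_swap[OF square_integrable_fst] by simp

text \<open>By the inequality of Cauchy and Schwarz on almost every row, the squared row mean is
  at most the mean of the squares, and the latter is integrable by Fubini's theorem.\<close>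

lemma square_integrable_row_mean:
  assumes k: "square_integrable (M \<Otimes>\<^sub>M M) k"
  shows "square_integrable M (\<lambda>x. \<integral>y. k (x, y) \<partial>M)"
proof -
  interpret Q: pair_prob_space M M ..
  have [measurable]: "k \<in> borel_measurable (M \<Otimes>\<^sub>M M)" and k2: "integrable (M \<Otimes>\<^sub>M M) (\<lambda>x. (k x)\<^sup>2)"
    using k by (auto simp: square_integrable_def)
  have "integrable M (\<lambda>x. (\<integral>y. k (x, y) \<partial>M)\<^sup>2)"
  proof (rule Bochner_Integration.integrable_bound[OF Q.integrable_fst'[OF k2]])
    show "AE x in M. norm ((\<integral>y. k (x, y) \<partial>M)\<^sup>2) \<le> norm (\<integral>y. (k (x, y))\<^sup>2 \<partial>M)"
      using Q.AE_integrable_fst'[OF k2] AE_space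
    proof eventually_elim
      case (elim x)
      then have "square_integrable M (\<lambda>y. k (x, y))"
        by (simp add: square_integrable_def)
      then have "(\<integral>y. k (x, y) \<partial>M)\<^sup>2 \<le> (\<integral>y. (k (x, y))\<^sup>2 \<partial>M)"
        by (rule expectation_square_le)
      then show ?case by simp
    qed
  qed simp
  then show ?thesis
    by (simp add: square_integrable_def)
qed

section \<open>Products of doubly centred kernels\<close>

lemma integral_times_row_mean:
  assumes k: "square_integrable (M \<Otimes>\<^sub>M M) k" and f: "square_integrable M f"
  shows "(\<integral>z. f (fst z) * k z \<partial>(M \<Otimes>\<^sub>M M)) = (\<integral>x. f x * (\<integral>y. k (x, y) \<partial>M) \<partial>M)"
proof -
  interpret Q: pair_prob_space M M ..
  show ?thesis
    using Q.integral_fst'[OF square_integrable_mult[OF square_integrable_fst[OF f] k]] by simp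
qed

lemma integral_times_row_mean_swap:
  assumes k: "square_integrable (M \<Otimes>\<^sub>M M) k" and f: "square_integrable M f"
    and sym: "\<And>x y. k (x, y) = k (y, x)"
  shows "(\<integral>z. f (snd z) * k z \<partial>(M \<Otimes>\<^sub>M M)) = (\<integral>x. f x * (\<integral>y. k (x, y) \<partial>M) \<partial>M)"
proof -
  interpret Q: pair_prob_space M M ..
  have [measurable]: "f \<in> borel_measurable M" "k \<in> borel_measurable (M \<Otimes>\<^sub>M M)"
    using f k by (auto simp: square_integrable_def)
  have "(\<integral>z. f (fst z) * k z \<partial>(M \<Otimes>\<^sub>M M)) = (\<integral>(x, y). f y * k (y, x) \<partial>(M \<Otimes>\<^sub>M M))"
    using Q.integral_product_swap[of "\<lambda>z. f (fst z) * k z"] by (simp add: case_prod_unfold)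
  also have "\<dots> = (\<integral>z. f (snd z) * k z \<partial>(M \<Otimes>\<^sub>M M))"
    by (simp add: case_prod_unfold sym[of "snd _"])
  finally show ?thesis
    using integral_times_row_mean[OF k f] by simp
qed

text \<open>The left-hand side is an inner product of two doubly centred kernels. The second one is
  orthogonal to all functions of a single coordinate, so the centring of the first one may be
  removed; the remaining product with \<open>k1\<close> is then expanded term by term.\<close>

lemma double_centred_product:
  fixes k1 k2 :: "'a \<times> 'a \<Rightarrow> real"
  assumes k1: "square_integrable (M \<Otimes>\<^sub>M M) k1" and k2: "square_integrable (M \<Otimes>\<^sub>M M) k2"
    and sym1: "\<And>x y. k1 (x, y) = k1 (y, x)" and sym2: "\<And>x y. k2 (x, y) = k2 (y, x)"
  defines "a1 \<equiv> \<lambda>x. \<integral>y. k1 (x, y) \<partial>M" and "a2 \<equiv> \<lambda>x. \<integral>y. k2 (x, y) \<partial>M"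
  defines "\<mu>1 \<equiv> \<integral>x. a1 x \<partial>M" and "\<mu>2 \<equiv> \<integral>x. a2 x \<partial>M"
  shows "(\<integral>z. (k1 z - a1 (fst z) - a1 (snd z) + \<mu>1) * (k2 z - a2 (fst z) - a2 (snd z) + \<mu>2) \<partial>(M \<Otimes>\<^sub>M M)) =
    (\<integral>z. k1 z * k2 z \<partial>(M \<Otimes>\<^sub>M M)) + \<mu>1 * \<mu>2 - 2 * (\<integral>x. a1 x * a2 x \<partial>M)"
proof -
  interpret Q: pair_prob_space M M ..
  have a: "square_integrable M a1" "square_integrable M a2"
    unfolding a1_def a2_def by (intro square_integrable_row_mean k1 k2)+
  define h where "h z = k2 z - a2 (fst z) - a2 (snd z) + \<mu>2" for z
  have h: "square_integrable (M \<Otimes>\<^sub>M M) h"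
    unfolding h_def
    by (intro square_integrable_add square_integrable_diff k2 square_integrable_fst square_integrable_snd a
        Q.P.square_integrable_const)
  have h_sym: "h (x, y) = h (y, x)" for x y
    by (simp add: h_def sym2[of x y])
  \<comment> \<open>Integrability of \<open>k2\<close> only gives integrability of almost every row, so the row means of \<open>h\<close> vanish almost everywhere.\<close>
  have "AE x in M. (\<integral>y. h (x, y) \<partial>M) = 0"
    using Q.AE_integrable_fst'[OF Q.P.square_integrable_integrable[OF k2]]
  proof eventually_elim
    case (elim x)
    then show ?case
      using square_integrable_integrable[OF a(2)]
      by (simp add: h_def prob_space a2_def[symmetric] \<mu>2_def[symmetric])
         (simp add: a2_def)
  qed
  then have h0: "(\<integral>x. f x * (\<integral>y. h (x, y) \<partial>M) \<partial>M) = 0" for f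
    by (intro integral_eq_zero_AE) auto
  note prods = square_integrable_mult[OF k1 h] square_integrable_mult[OF square_integrable_fst[OF a(1)] h]
    square_integrable_mult[OF square_integrable_snd[OF a(1)] h] Q.P.square_integrable_integrable[OF h]
  \<comment> \<open>Orthogonality of \<open>h\<close> to functions of one coordinate removes the centring of \<open>k1\<close>.\<close>
  have 1: "(\<integral>z. (k1 z - a1 (fst z) - a1 (snd z) + \<mu>1) * h z \<partial>(M \<Otimes>\<^sub>M M)) = (\<integral>z. k1 z * h z \<partial>(M \<Otimes>\<^sub>M M))"
    using prods integral_times_row_mean[OF h a(1)] integral_times_row_mean_swap[OF h a(1) h_sym]
      integral_times_row_mean[OF h square_integrable_const[of 1]] h0[of "\<lambda>_. 1"]
    by (simp add: left_diff_distrib distrib_right h0)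
  have 2: "(\<integral>z. k1 z * h z \<partial>(M \<Otimes>\<^sub>M M)) =
     (\<integral>z. k1 z * k2 z - a2 (fst z) * k1 z - a2 (snd z) * k1 z + \<mu>2 * k1 z \<partial>(M \<Otimes>\<^sub>M M))"
    by (simp add: h_def algebra_simps)
  also have "\<dots> = (\<integral>z. k1 z * k2 z \<partial>(M \<Otimes>\<^sub>M M)) - (\<integral>z. a2 (fst z) * k1 z \<partial>(M \<Otimes>\<^sub>M M))
       - (\<integral>z. a2 (snd z) * k1 z \<partial>(M \<Otimes>\<^sub>M M)) + \<mu>2 * (\<integral>z. k1 z \<partial>(M \<Otimes>\<^sub>M M))"
    using square_integrable_mult[OF k1 k2] square_integrable_mult[OF square_integrable_fst[OF a(2)] k1]
      square_integrable_mult[OF square_integrable_snd[OF a(2)] k1] Q.P.square_integrable_integrable[OF k1]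
    by simp
  also have "(\<integral>z. a2 (fst z) * k1 z \<partial>(M \<Otimes>\<^sub>M M)) = (\<integral>x. a1 x * a2 x \<partial>M)"
    using integral_times_row_mean[OF k1 a(2)] by (simp add: a1_def mult.commute)
  also have "(\<integral>z. a2 (snd z) * k1 z \<partial>(M \<Otimes>\<^sub>M M)) = (\<integral>x. a1 x * a2 x \<partial>M)"
    using integral_times_row_mean_swap[OF k1 a(2) sym1] by (simp add: a1_def mult.commute)
  also have "(\<integral>z. k1 z \<partial>(M \<Otimes>\<^sub>M M)) = \<mu>1"
    using Q.integral_fst'[OF Q.P.square_integrable_integrable[OF k1]] by (simp add: \<mu>1_def a1_def)
  finally show ?thesis
    using 1 by (simp add: h_def mult.commute)
qed

end

section \<open>Bergsma's covariance in terms of copies\<close>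

text \<open>By the triangle inequality a finite second moment makes all four summands of the defining
  integral integrable, so the integral may be split.\<close>

lemma bergsma_h_eq:
  assumes D: "real_distribution D" and id: "square_integrable D (\<lambda>x. x)"
  shows "bergsma_h (cdf D) x y =
    - (1 / 2) * (\<bar>x - y\<bar> - (\<integral>z. \<bar>x - z\<bar> \<partial>D) - (\<integral>z. \<bar>y - z\<bar> \<partial>D) + (\<integral>x. (\<integral>y. \<bar>x - y\<bar> \<partial>D) \<partial>D))"
proof -
  interpret D: real_distribution D by fact
  interpret pair_prob_space D D ..
  have i1: "integrable (D \<Otimes>\<^sub>M D) (\<lambda>z. \<bar>x - snd z\<bar>)"
    by (intro P.square_integrable_integrable square_integrable_abs square_integrable_diff
        P.square_integrable_const D.square_integrable_snd id)
  have i2: "integrable (D \<Otimes>\<^sub>M D) (\<lambda>z. \<bar>fst z - y\<bar>)"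
    by (intro P.square_integrable_integrable square_integrable_abs square_integrable_diff
        P.square_integrable_const D.square_integrable_fst id)
  have i3: "integrable (D \<Otimes>\<^sub>M D) (\<lambda>z. \<bar>fst z - snd z\<bar>)"
    by (intro P.square_integrable_integrable square_integrable_abs square_integrable_diff
        D.square_integrable_fst D.square_integrable_snd id)
  have "bergsma_h (cdf D) x y = - (1 / 2) *
     (\<integral>z. (\<bar>x - y\<bar> - \<bar>x - snd z\<bar> - \<bar>fst z - y\<bar> + \<bar>fst z - snd z\<bar>) \<partial>(D \<Otimes>\<^sub>M D))"
    by (simp add: bergsma_h_def interval_measure_cdf[OF D] case_prod_unfold)
  also have "(\<integral>z. (\<bar>x - y\<bar> - \<bar>x - snd z\<bar> - \<bar>fst z - y\<bar> + \<bar>fst z - snd z\<bar>) \<partial>(D \<Otimes>\<^sub>M D)) =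
     \<bar>x - y\<bar> - (\<integral>z. \<bar>x - snd z\<bar> \<partial>(D \<Otimes>\<^sub>M D)) - (\<integral>z. \<bar>fst z - y\<bar> \<partial>(D \<Otimes>\<^sub>M D))
      + (\<integral>z. \<bar>fst z - snd z\<bar> \<partial>(D \<Otimes>\<^sub>M D))"
    using i1 i2 i3 by (simp add: P.prob_space)
  finally show ?thesis
    using integral_fst'[OF i1] integral_fst'[OF i2] integral_fst'[OF i3] D.prob_space
    by (simp add: abs_minus_commute)
qed

text \<open>Independent copies enter expectations only through their joint law, a product of copies of
  the law of \<open>(X, Y)\<close>; its coordinates are then integrated one after the other.\<close>

lemma nn_integral_iid_copies:
  fixes X Y :: "'a \<Rightarrow> real" and X' Y' :: "'i \<Rightarrow> 'b \<Rightarrow> real"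
  assumes N: "prob_space N" and M: "prob_space M"
    and X: "X \<in> borel_measurable N" and Y: "Y \<in> borel_measurable N"
    and copies: "iid_copies N X Y M X' Y' I"
    and ijk: "i \<in> I" "j \<in> I" "k \<in> I" "i \<noteq> j" "i \<noteq> k" "j \<noteq> k"
  defines "B \<equiv> borel \<Otimes>\<^sub>M borel :: (real \<times> real) measure"
  defines "P \<equiv> distr N B (\<lambda>\<omega>. (X \<omega>, Y \<omega>))"
  assumes F: "F \<in> borel_measurable (B \<Otimes>\<^sub>M B \<Otimes>\<^sub>M B)"
  shows "(\<integral>\<^sup>+\<omega>. F ((X' i \<omega>, Y' i \<omega>), (X' j \<omega>, Y' j \<omega>), (X' k \<omega>, Y' k \<omega>)) \<partial>M) =
    (\<integral>\<^sup>+p. \<integral>\<^sup>+q. \<integral>\<^sup>+r. F (p, q, r) \<partial>P \<partial>P \<partial>P)"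
proof -
  interpret N: prob_space N by fact
  interpret M: prob_space M by fact
  note [measurable] = X Y F
  interpret P: prob_space P
    unfolding P_def B_def by (rule N.prob_space_distr) measurable
  interpret product_sigma_finite "\<lambda>_::'i. P" ..
  have [measurable_cong]: "sets P = sets B"
    by (simp add: P_def)
  let ?Z = "\<lambda>i \<omega>. (X' i \<omega>, Y' i \<omega>)"
  let ?J = "{i, j, k}"
  have ind: "M.indep_vars (\<lambda>_. B) ?Z ?J"
  proof (rule M.indep_vars_subset)
    show "M.indep_vars (\<lambda>_. B) ?Z I"
      using copies unfolding iid_copies_def B_def by (rule conjunct1)
  qed (use ijk in simp)
  have laws: "distr M B (?Z l) = P" if "l \<in> ?J" for l
  proof -
    have "l \<in> I" using that ijk by blast
    then show ?thesis using copies unfolding iid_copies_def P_def B_def by blast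
  qed
  have Z[measurable]: "?Z l \<in> measurable M B" if "l \<in> ?J" for l
    using ind that unfolding M.indep_vars_def by blast
  have "distr M (PiM ?J (\<lambda>_. B)) (\<lambda>\<omega>. \<lambda>l\<in>?J. ?Z l \<omega>) = PiM ?J (\<lambda>l. distr M B (?Z l))"
    using M.indep_vars_iff_distr_eq_PiM'[of ?J ?Z "\<lambda>_. B"] ind Z by blast
  also have "\<dots> = PiM ?J (\<lambda>_. P)"
    by (intro PiM_cong refl laws)
  finally have law: "distr M (PiM ?J (\<lambda>_. B)) (\<lambda>\<omega>. \<lambda>l\<in>?J. ?Z l \<omega>) = PiM ?J (\<lambda>_. P)" .
  have "(\<integral>\<^sup>+\<omega>. F (?Z i \<omega>, ?Z j \<omega>, ?Z k \<omega>) \<partial>M) =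
      (\<integral>\<^sup>+z. F (z i, z j, z k) \<partial>distr M (PiM ?J (\<lambda>_. B)) (\<lambda>\<omega>. \<lambda>l\<in>?J. ?Z l \<omega>))"
    by (subst nn_integral_distr) auto
  also have "\<dots> = (\<integral>\<^sup>+p. \<integral>\<^sup>+q. \<integral>\<^sup>+r. F (p, q, r) \<partial>P \<partial>P \<partial>P)"
  proof -
    have "(\<integral>\<^sup>+z. F (z i, z j, z k) \<partial>PiM ?J (\<lambda>_. P)) = (\<integral>\<^sup>+p. \<integral>\<^sup>+z. F (p, z j, z k) \<partial>PiM {j, k} (\<lambda>_. P) \<partial>P)"
      using ijk product_nn_integral_insert_rev[of "{j, k}" i "\<lambda>z. F (z i, z j, z k)"] by simp
    moreover have "(\<integral>\<^sup>+z. F (p, z j, z k) \<partial>PiM {j, k} (\<lambda>_. P)) = (\<integral>\<^sup>+q. \<integral>\<^sup>+z. F (p, q, z k) \<partial>PiM {k} (\<lambda>_. P) \<partial>P)"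
      if [measurable]: "p \<in> space B" for p
      using ijk product_nn_integral_insert_rev[of "{k}" j "\<lambda>z. F (p, z j, z k)"] by simp
    moreover have "(\<integral>\<^sup>+z. F (p, q, z k) \<partial>PiM {k} (\<lambda>_. P)) = (\<integral>\<^sup>+r. F (p, q, r) \<partial>P)"
      if [measurable]: "p \<in> space B" "q \<in> space B" for p q
      by (rule product_nn_integral_singleton) simp
    ultimately show ?thesis
      unfolding law by (simp add: B_def space_pair_measure)
  qed
  finally show ?thesis .
qed

text \<open>After the factors \<open>- 1 / 2\<close> are taken out, the functions \<open>bergsma_h\<close> are the doubly centred
  distance kernels of the two coordinates. A third copy is what expresses the product of the
  two row means at one point as an expectation of distances.\<close>

lemma bergsma_cov_iid_copies:
  assumes N: "prob_space N" and M: "prob_space M"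
    and X: "square_integrable N X" and Y: "square_integrable N Y"
    and copies: "iid_copies N X Y M X' Y' I"
    and ijk: "i \<in> I" "j \<in> I" "k \<in> I" "i \<noteq> j" "i \<noteq> k" "j \<noteq> k"
  shows "bergsma_cov N X Y = 1 / 4 *
    ((\<integral>\<omega>. \<bar>X' i \<omega> - X' j \<omega>\<bar> * \<bar>Y' i \<omega> - Y' j \<omega>\<bar> \<partial>M)
     + (\<integral>\<omega>. \<bar>X' i \<omega> - X' j \<omega>\<bar> \<partial>M) * (\<integral>\<omega>. \<bar>Y' i \<omega> - Y' j \<omega>\<bar> \<partial>M)
     - 2 * (\<integral>\<omega>. \<bar>X' i \<omega> - X' j \<omega>\<bar> * \<bar>Y' i \<omega> - Y' k \<omega>\<bar> \<partial>M))"
proof -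
  interpret N: prob_space N by fact
  interpret M: prob_space M by fact
  let ?B = "borel \<Otimes>\<^sub>M borel :: (real \<times> real) measure"
  define P where "P = distr N ?B (\<lambda>\<omega>. (X \<omega>, Y \<omega>))"
  have mX[measurable]: "X \<in> borel_measurable N" and mY[measurable]: "Y \<in> borel_measurable N"
    using X Y by (simp_all add: square_integrable_def)
  interpret P: prob_space P
    unfolding P_def by (rule N.prob_space_distr) measurable
  interpret PP: pair_prob_space P P ..
  have [measurable_cong]: "sets P = sets (borel \<Otimes>\<^sub>M borel)"
    by (simp add: P_def)
  have marg: "(\<integral>z. f z \<partial>distr N borel X) = (\<integral>p. f (fst p) \<partial>P)"
    "(\<integral>z. f z \<partial>distr N borel Y) = (\<integral>p. f (snd p) \<partial>P)"
    if [measurable]: "f \<in> borel_measurable borel" for f :: "real \<Rightarrow> real"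
    by (simp_all add: P_def integral_distr)
  have L: "square_integrable P fst" "square_integrable P snd"
    using X Y by (auto simp: square_integrable_def P_def integrable_distr_eq)
  have L1: "square_integrable (distr N borel X) (\<lambda>x. x)" "square_integrable (distr N borel Y) (\<lambda>x. x)"
    using X Y by (auto simp: square_integrable_def integrable_distr_eq)
  define k1 :: "(real \<times> real) \<times> (real \<times> real) \<Rightarrow> real" where "k1 z = \<bar>fst (fst z) - fst (snd z)\<bar>" for z
  define k2 :: "(real \<times> real) \<times> (real \<times> real) \<Rightarrow> real" where "k2 z = \<bar>snd (fst z) - snd (snd z)\<bar>" for z
  have [measurable]: "k1 \<in> borel_measurable (?B \<Otimes>\<^sub>M ?B)" "k2 \<in> borel_measurable (?B \<Otimes>\<^sub>M ?B)"
    unfolding k1_def k2_def by measurable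
  have k: "square_integrable (P \<Otimes>\<^sub>M P) k1" "square_integrable (P \<Otimes>\<^sub>M P) k2"
    unfolding k1_def k2_def
    by (intro square_integrable_abs square_integrable_diff
        P.square_integrable_fst[OF L(1)] P.square_integrable_snd[OF L(1)]
        P.square_integrable_fst[OF L(2)] P.square_integrable_snd[OF L(2)])+
  define a1 where "a1 p = (\<integral>q. k1 (p, q) \<partial>P)" for p
  define a2 where "a2 p = (\<integral>q. k2 (p, q) \<partial>P)" for p
  define m1 where "m1 = (\<integral>p. a1 p \<partial>P)"
  define m2 where "m2 = (\<integral>p. a2 p \<partial>P)"
  have h1: "bergsma_h (cdf (distr N borel X)) (fst p) (fst q) = - (1 / 2) * (k1 (p, q) - a1 p - a1 q + m1)" for p q
    by (subst bergsma_h_eq[OF N.real_distribution_distr[OF mX] L1(1)])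
       (simp add: marg k1_def a1_def m1_def)
  have h2: "bergsma_h (cdf (distr N borel Y)) (snd p) (snd q) = - (1 / 2) * (k2 (p, q) - a2 p - a2 q + m2)" for p q
    by (subst bergsma_h_eq[OF N.real_distribution_distr[OF mY] L1(2)])
       (simp add: marg k2_def a2_def m2_def)
  have "bergsma_cov N X Y = (\<integral>z. bergsma_h (cdf (distr N borel X)) (fst (fst z)) (fst (snd z)) *
      bergsma_h (cdf (distr N borel Y)) (snd (fst z)) (snd (snd z)) \<partial>(P \<Otimes>\<^sub>M P))"
    by (simp add: bergsma_cov_def Let_def P_def case_prod_unfold)
  also have "\<dots> = (\<integral>z. 1 / 4 * ((k1 z - a1 (fst z) - a1 (snd z) + m1) * (k2 z - a2 (fst z) - a2 (snd z) + m2)) \<partial>(P \<Otimes>\<^sub>M P))"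
    by (simp add: h1 h2)
  also have "\<dots> = 1 / 4 * ((\<integral>z. k1 z * k2 z \<partial>(P \<Otimes>\<^sub>M P)) + m1 * m2 - 2 * (\<integral>p. a1 p * a2 p \<partial>P))"
    using P.double_centred_product[OF k]
    by (simp add: a1_def a2_def m1_def m2_def k1_def k2_def abs_minus_commute)
  finally have expansion: "bergsma_cov N X Y = \<dots>" .

  let ?Z = "\<lambda>i \<omega>. (X' i \<omega>, Y' i \<omega>)"
  have [measurable]: "?Z l \<in> measurable M (borel \<Otimes>\<^sub>M borel)" if "l \<in> I" for l
    using copies that by (auto simp: iid_copies_def M.indep_vars_def2)
  note transfer = nn_integral_iid_copies[OF N M mX mY copies ijk, folded P_def]
  have pair: "(\<integral>\<omega>. f (?Z i \<omega>, ?Z j \<omega>) \<partial>M) = (\<integral>z. f z \<partial>(P \<Otimes>\<^sub>M P))"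
    if [measurable]: "f \<in> borel_measurable (?B \<Otimes>\<^sub>M ?B)" and nonneg: "\<And>z. f z \<ge> 0"
    for f :: "_ \<Rightarrow> real"
  proof -
    \<comment> \<open>The third copy integrates to one.\<close>
    have "(\<integral>\<^sup>+\<omega>. ennreal (f (?Z i \<omega>, ?Z j \<omega>)) \<partial>M) = (\<integral>\<^sup>+z. ennreal (f z) \<partial>(P \<Otimes>\<^sub>M P))"
      using transfer[of "\<lambda>(p, q, r). ennreal (f (p, q))"]
      by (simp add: P.nn_integral_fst[symmetric] P.emeasure_space_1)
    then show ?thesis
      using ijk nonneg by (simp add: integral_eq_nn_integral)
  qed
  have "(\<lambda>z. k1 z * k2 z) \<in> borel_measurable (?B \<Otimes>\<^sub>M ?B)"
    by measurable
  from pair[OF this]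
  have \<mu>12: "(\<integral>\<omega>. \<bar>X' i \<omega> - X' j \<omega>\<bar> * \<bar>Y' i \<omega> - Y' j \<omega>\<bar> \<partial>M) = (\<integral>z. k1 z * k2 z \<partial>(P \<Otimes>\<^sub>M P))"
    by (simp add: k1_def k2_def)
  have \<mu>1: "(\<integral>\<omega>. \<bar>X' i \<omega> - X' j \<omega>\<bar> \<partial>M) = m1"
    using pair[of k1] PP.integral_fst'[OF PP.P.square_integrable_integrable[OF k(1)]]
    by (simp add: m1_def a1_def) (simp add: k1_def)
  have \<mu>2: "(\<integral>\<omega>. \<bar>Y' i \<omega> - Y' j \<omega>\<bar> \<partial>M) = m2"
    using pair[of k2] PP.integral_fst'[OF PP.P.square_integrable_integrable[OF k(2)]]
    by (simp add: m2_def a2_def) (simp add: k2_def)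
  have \<mu>3: "(\<integral>\<omega>. \<bar>X' i \<omega> - X' j \<omega>\<bar> * \<bar>Y' i \<omega> - Y' k \<omega>\<bar> \<partial>M) = (\<integral>p. a1 p * a2 p \<partial>P)"
  proof -
    have "(\<integral>\<^sup>+\<omega>. ennreal (k1 (?Z i \<omega>, ?Z j \<omega>) * k2 (?Z i \<omega>, ?Z k \<omega>)) \<partial>M) =
       (\<integral>\<^sup>+p. \<integral>\<^sup>+q. \<integral>\<^sup>+r. ennreal (k1 (p, q) * k2 (p, r)) \<partial>P \<partial>P \<partial>P)"
      using transfer[of "\<lambda>(p, q, r). ennreal (k1 (p, q) * k2 (p, r))"] by simp
    also have "\<dots> = (\<integral>\<^sup>+p. ennreal (a1 p * a2 p) \<partial>P)"
      using PP.AE_integrable_fst'[OF PP.P.square_integrable_integrable[OF k(1)]]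
        PP.AE_integrable_fst'[OF PP.P.square_integrable_integrable[OF k(2)]]
    proof (intro nn_integral_cong_AE, eventually_elim)
      case (elim p)
      have pos: "0 \<le> k1 z" "0 \<le> k2 z" for z
        by (simp_all add: k1_def k2_def)
      have [measurable]: "(\<lambda>q. k1 (p, q)) \<in> borel_measurable P" "(\<lambda>q. k2 (p, q)) \<in> borel_measurable P"
        unfolding k1_def k2_def fst_conv snd_conv by measurable
      have "(\<integral>\<^sup>+q. \<integral>\<^sup>+r. ennreal (k1 (p, q) * k2 (p, r)) \<partial>P \<partial>P) =
          (\<integral>\<^sup>+q. ennreal (k1 (p, q)) \<partial>P) * (\<integral>\<^sup>+r. ennreal (k2 (p, r)) \<partial>P)"
        by (simp add: ennreal_mult pos nn_integral_cmult nn_integral_multc)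
      also have "\<dots> = ennreal (a1 p) * ennreal (a2 p)"
        using elim pos by (simp add: nn_integral_eq_integral a1_def a2_def)
      also have "\<dots> = ennreal (a1 p * a2 p)"
        using pos by (simp add: a1_def a2_def ennreal_mult)
      finally show ?case .
    qed
    finally have "(\<integral>\<omega>. k1 (?Z i \<omega>, ?Z j \<omega>) * k2 (?Z i \<omega>, ?Z k \<omega>) \<partial>M) = (\<integral>p. a1 p * a2 p \<partial>P)"
      using ijk by (simp add: integral_eq_nn_integral a1_def a2_def k1_def k2_def)
    then show ?thesis by (simp add: k1_def k2_def)
  qed
  show ?thesis
    unfolding expansion \<mu>12 \<mu>1 \<mu>2 \<mu>3 ..
qed

section \<open>Rotations of the standard normal law in the plane\<close>

abbreviation std_normal :: "real measure" where
  "std_normal \<equiv> density lborel std_normal_density"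

lemma prob_space_std_normal: "prob_space std_normal"
  by (rule prob_space_normal_density) simp

interpretation std_normal: prob_space std_normal
  by (rule prob_space_std_normal)

interpretation std_normal_pair: pair_prob_space std_normal std_normal ..

lemma emeasure_std_normal_UNIV [simp]: "emeasure std_normal UNIV = 1"
  using std_normal.emeasure_space_1 by simp

lemma nn_integral_std_normal:
  assumes "f \<in> borel_measurable borel"
  shows "(\<integral>\<^sup>+x. f x \<partial>std_normal) = (\<integral>\<^sup>+x. ennreal (std_normal_density x) * f x \<partial>lborel)"
  using assms by (subst nn_integral_density) auto

lemma nn_integral_std_normal_pair:
  assumes [measurable]: "F \<in> borel_measurable (borel \<Otimes>\<^sub>M borel)"
  shows "(\<integral>\<^sup>+x. \<integral>\<^sup>+y. F (x, y) \<partial>std_normal \<partial>std_normal) =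
    (\<integral>\<^sup>+x. \<integral>\<^sup>+y. ennreal (std_normal_density x * std_normal_density y) * F (x, y) \<partial>lborel \<partial>lborel)"
  by (simp add: nn_integral_std_normal nn_integral_cmult[symmetric] ennreal_mult' mult.assoc)

lemma std_normal_density_rotate:
  assumes "a\<^sup>2 + b\<^sup>2 = (1::real)"
  shows "std_normal_density (a * x + b * y) * std_normal_density (a * y - b * x) =
         std_normal_density x * std_normal_density y"
proof -
  have "(a * x + b * y)\<^sup>2 + (a * y - b * x)\<^sup>2 = (a\<^sup>2 + b\<^sup>2) * (x\<^sup>2 + y\<^sup>2)"
    by algebra
  with assms have *: "- (a * x + b * y)\<^sup>2 / 2 + - (a * y - b * x)\<^sup>2 / 2 = - x\<^sup>2 / 2 + - y\<^sup>2 / 2"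
    by (simp add: field_simps)
  have "exp (- (a * x + b * y)\<^sup>2 / 2) * exp (- (a * y - b * x)\<^sup>2 / 2) =
        exp (- x\<^sup>2 / 2) * exp (- y\<^sup>2 / 2)"
    unfolding exp_add[symmetric] * ..
  then show ?thesis
    by (simp add: std_normal_density_def field_simps)
qed

text \<open>A rotation other than a quarter turn factors into two maps that each change a single
  coordinate, affinely and with slopes \<open>1 / a\<close> and \<open>a\<close>. The two Jacobians cancel, and the planar
  density depends only on the distance from the origin.\<close>

lemma std_normal_rotate:
  fixes a b :: real
  assumes ab: "a\<^sup>2 + b\<^sup>2 = 1" and a: "a \<noteq> 0"
    and F[measurable]: "F \<in> borel_measurable (borel \<Otimes>\<^sub>M borel)"
  shows "(\<integral>\<^sup>+x. \<integral>\<^sup>+y. F (a * x + b * y, a * y - b * x) \<partial>std_normal \<partial>std_normal) =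
         (\<integral>\<^sup>+x. \<integral>\<^sup>+y. F (x, y) \<partial>std_normal \<partial>std_normal)"
proof -
  let ?H = "\<lambda>x y. ennreal (std_normal_density x * std_normal_density y) * F (x, y)"
  have 1: "(\<integral>\<^sup>+y. ?H x y \<partial>lborel) = (\<integral>\<^sup>+y. \<bar>1/a\<bar> * ?H x (- (b / a) * x + (1/a) * y) \<partial>lborel)" for x
    by (subst nn_integral_real_affine[where c="1/a" and t="- (b / a) * x"])
       (use a in \<open>auto intro: nn_integral_cmult[symmetric]\<close>)
  have 2: "(\<integral>\<^sup>+x. \<bar>1/a\<bar> * ?H x (- (b / a) * x + (1/a) * y) \<partial>lborel) =
     (\<integral>\<^sup>+x. ennreal (std_normal_density x * std_normal_density y) * F (a * x + b * y, a * y - b * x) \<partial>lborel)" for y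
  proof -
    have arg: "- (b / a) * (b * y + a * x) + (1/a) * y = a * y - b * x" for x
    proof -
      have "- (b / a) * (b * y + a * x) + (1/a) * y = (1 - b\<^sup>2) / a * y - b * x"
        using a by (simp add: field_simps power2_eq_square)
      also have "1 - b\<^sup>2 = a * a"
        using ab by (simp add: power2_eq_square)
      finally show ?thesis using a by simp
    qed
    have "(\<integral>\<^sup>+x. \<bar>1/a\<bar> * ?H x (- (b / a) * x + (1/a) * y) \<partial>lborel) =
      (\<integral>\<^sup>+x. \<bar>a\<bar> * (\<bar>1/a\<bar> * ?H (b * y + a * x) (a * y - b * x)) \<partial>lborel)"
      apply (subst nn_integral_real_affine[OF _ a, where t="b * y"])
       apply measurable
      apply (unfold arg)
      apply (rule nn_integral_cmult[symmetric])
      apply measurable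
      done
    also have "\<dots> = (\<integral>\<^sup>+x. ?H (a * x + b * y) (a * y - b * x) \<partial>lborel)"
      using a by (simp add: mult.assoc[symmetric] ennreal_mult'[symmetric] add.commute)
    finally show ?thesis
      using std_normal_density_rotate[OF ab] by simp
  qed
  have "(\<integral>\<^sup>+x. \<integral>\<^sup>+y. F (x, y) \<partial>std_normal \<partial>std_normal) =
    (\<integral>\<^sup>+x. \<integral>\<^sup>+y. \<bar>1/a\<bar> * ?H x (- (b / a) * x + (1/a) * y) \<partial>lborel \<partial>lborel)"
    by (simp only: nn_integral_std_normal_pair[OF F] 1)
  also have "\<dots> = (\<integral>\<^sup>+y. \<integral>\<^sup>+x. \<bar>1/a\<bar> * ?H x (- (b / a) * x + (1/a) * y) \<partial>lborel \<partial>lborel)"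
    by (rule lborel_pair.Fubini'[symmetric]) simp
  also have "\<dots> = (\<integral>\<^sup>+x. \<integral>\<^sup>+y. ennreal (std_normal_density x * std_normal_density y) * F (a * x + b * y, a * y - b * x) \<partial>lborel \<partial>lborel)"
    unfolding 2 by (rule lborel_pair.Fubini') simp
  also have "\<dots> = (\<integral>\<^sup>+x. \<integral>\<^sup>+y. F (a * x + b * y, a * y - b * x) \<partial>std_normal \<partial>std_normal)"
    by (subst nn_integral_std_normal_pair[of "\<lambda>(x, y). F (a * x + b * y, a * y - b * x)", simplified]) simp_all
  finally show ?thesis ..
qed

lemma std_normal_swap:
  assumes "case_prod f \<in> borel_measurable (borel \<Otimes>\<^sub>M borel)"
  shows "(\<integral>\<^sup>+x. \<integral>\<^sup>+y. f x y \<partial>std_normal \<partial>std_normal) = (\<integral>\<^sup>+y. \<integral>\<^sup>+x. f x y \<partial>std_normal \<partial>std_normal)"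
  using assms by (intro std_normal_pair.Fubini'[symmetric]) simp

text \<open>A linear combination of independent standard normal variables is its standard deviation
  \<open>sqrt (a\<^sup>2 + b\<^sup>2)\<close> times the first coordinate of a rotated pair. If only \<open>b\<close> is nonzero, the two
  variables first exchange their roles.\<close>

lemma std_normal_linear_combination:
  fixes a b :: real
  assumes f[measurable]: "f \<in> borel_measurable borel"
  shows "(\<integral>\<^sup>+x. \<integral>\<^sup>+y. f (a * x + b * y) \<partial>std_normal \<partial>std_normal) =
         (\<integral>\<^sup>+x. f (sqrt (a\<^sup>2 + b\<^sup>2) * x) \<partial>std_normal)"
proof -
  have main: "(\<integral>\<^sup>+x. \<integral>\<^sup>+y. f (a * x + b * y) \<partial>std_normal \<partial>std_normal) =
         (\<integral>\<^sup>+x. f (sqrt (a\<^sup>2 + b\<^sup>2) * x) \<partial>std_normal)" if a: "a \<noteq> 0" for a b :: real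
  proof -
    define r where "r = sqrt (a\<^sup>2 + b\<^sup>2)"
    have r: "r > 0" "r\<^sup>2 = a\<^sup>2 + b\<^sup>2"
      using a by (auto simp: r_def sum_power2_gt_zero_iff)
    have "(a / r)\<^sup>2 + (b / r)\<^sup>2 = 1"
      using r by (simp add: power_divide flip: add_divide_distrib r(2))
    moreover have "a / r \<noteq> 0"
      using a r by simp
    ultimately have "(\<integral>\<^sup>+x. \<integral>\<^sup>+y. f (r * (a / r * x + b / r * y)) \<partial>std_normal \<partial>std_normal) =
           (\<integral>\<^sup>+x. \<integral>\<^sup>+y. f (r * x) \<partial>std_normal \<partial>std_normal)"
      using std_normal_rotate[of "a / r" "b / r" "\<lambda>p. f (r * fst p)"] by simp
    moreover have "r * (a / r * x + b / r * y) = a * x + b * y" for x y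
      using r by (simp add: field_simps)
    ultimately show ?thesis
      by (simp add: r_def)
  qed
  show ?thesis
  proof (cases "a = 0")
    case False
    then show ?thesis by (rule main)
  next
    case True
    show ?thesis
    proof (cases "b = 0")
      case True
      with \<open>a = 0\<close> show ?thesis by simp
    next
      case False
      have "(\<integral>\<^sup>+x. \<integral>\<^sup>+y. f (a * x + b * y) \<partial>std_normal \<partial>std_normal) =
            (\<integral>\<^sup>+y. \<integral>\<^sup>+x. f (b * y + a * x) \<partial>std_normal \<partial>std_normal)"
        by (subst std_normal_swap) (simp_all add: add.commute)
      with main[OF False, of a] show ?thesis by (simp add: add.commute)
    qed
  qed
qed

lemma std_normal_abs_moment:
  "(\<integral>\<^sup>+x. ennreal \<bar>x\<bar> \<partial>std_normal) = ennreal (sqrt (2 / pi))"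
proof -
  have "(\<integral>\<^sup>+x. ennreal \<bar>x\<bar> \<partial>std_normal) = (\<integral>\<^sup>+x. ennreal (std_normal_density x * \<bar>x\<bar>) \<partial>lborel)"
    by (simp add: nn_integral_std_normal ennreal_mult')
  also have "\<dots> = ennreal (sqrt (2 / pi))"
    using std_normal_moment_abs_odd[of 0]
    by (subst nn_integral_eq_integral) (auto simp: has_bochner_integral_iff)
  finally show ?thesis .
qed

section \<open>The absolute product moment of a standard bivariate normal law\<close>

text \<open>The integrand vanishes at the left end point \<open>- \<rho> / c\<close> and is nonnegative beyond it. With
  \<open>\<rho> = sin \<alpha>\<close> that point is \<open>- tan \<alpha>\<close>, which is how the arcsine arises. The first conclusion, that the
  value is nonnegative, is recorded because \<open>ennreal\<close> sends negative numbers to zero and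
  is additive only on nonnegative ones.\<close>

lemma nn_integral_arcsin_half_line:
  fixes \<rho> :: real
  assumes \<rho>: "\<bar>\<rho>\<bar> < 1"
  defines "c \<equiv> sqrt (1 - \<rho>\<^sup>2)"
  shows "0 \<le> \<rho> * pi / 4 + (\<rho> * arcsin \<rho> + c) / 2"
    and "(\<integral>\<^sup>+t. ennreal ((\<rho> + c * t) / (1 + t\<^sup>2)\<^sup>2) * indicator {- \<rho> / c..} t \<partial>lborel) =
         ennreal (\<rho> * pi / 4 + (\<rho> * arcsin \<rho> + c) / 2)"
proof -
  have \<rho>2: "\<rho>\<^sup>2 < 1"
    using \<rho> by (simp add: abs_square_less_1)
  then have c: "c > 0" "c\<^sup>2 = 1 - \<rho>\<^sup>2"
    by (auto simp: c_def)
  define F where "F t = \<rho> / 2 * (t / (1 + t\<^sup>2) + arctan t) - c / (2 * (1 + t\<^sup>2))" for t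
  have pos: "1 + t\<^sup>2 > 0" for t :: real
    by (simp add: add_pos_nonneg)
  have deriv: "DERIV F t :> (\<rho> + c * t) / (1 + t\<^sup>2)\<^sup>2" for t
  proof -
    have "1 + t\<^sup>2 \<noteq> 0"
      using pos[of t] by simp
    then show ?thesis
      unfolding F_def
      by (auto intro!: derivative_eq_intros simp: power2_eq_square)
         (simp add: divide_simps; simp add: algebra_simps)
  qed
  have lim: "(F \<longlongrightarrow> \<rho> * pi / 4) at_top"
    unfolding F_def by real_asymp
  have F0: "F (- \<rho> / c) = - (\<rho> * arcsin \<rho> + c) / 2"
  proof -
    have 1: "1 + (- \<rho> / c)\<^sup>2 = 1 / c\<^sup>2"
      using c by (simp add: power_divide field_simps)
    have 2: "arctan (- \<rho> / c) = - arcsin \<rho>"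
      using \<rho> by (simp add: arcsin_arctan c_def arctan_minus)
    have "F (- \<rho> / c) = \<rho> / 2 * (- \<rho> * c - arcsin \<rho>) - c * c\<^sup>2 / 2"
      unfolding F_def 1 2 using c by (simp add: field_simps power2_eq_square)
    also have "\<dots> = - (\<rho> * arcsin \<rho> + c) / 2"
      unfolding c(2) by (simp add: field_simps power2_eq_square)
    finally show ?thesis .
  qed
  have nonneg: "0 \<le> (\<rho> + c * t) / (1 + t\<^sup>2)\<^sup>2" if "- \<rho> / c \<le> t" for t
    using c that by (auto simp: field_simps)
  have "F (- \<rho> / c) \<le> F t" if "- \<rho> / c \<le> t" for t
    using that by (rule DERIV_nonneg_imp_nondecreasing) (use deriv nonneg in blast)
  then have "F (- \<rho> / c) \<le> \<rho> * pi / 4"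
    by (intro tendsto_lowerbound[OF lim] eventually_at_top_linorderI) auto
  then show "0 \<le> \<rho> * pi / 4 + (\<rho> * arcsin \<rho> + c) / 2"
    unfolding F0 by (simp add: field_simps)
  have "(\<integral>\<^sup>+t. ennreal ((\<rho> + c * t) / (1 + t\<^sup>2)\<^sup>2) * indicator {- \<rho> / c..} t \<partial>lborel) =
        ennreal (\<rho> * pi / 4 - F (- \<rho> / c))"
    by (intro nn_integral_FTC_atLeast deriv lim nonneg) simp
  then show "(\<integral>\<^sup>+t. ennreal ((\<rho> + c * t) / (1 + t\<^sup>2)\<^sup>2) * indicator {- \<rho> / c..} t \<partial>lborel) =
         ennreal (\<rho> * pi / 4 + (\<rho> * arcsin \<rho> + c) / 2)"
    unfolding F0 by (simp add: field_simps)
qed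


text \<open>The part of the line left of the zero \<open>- \<rho> / c\<close> is reflected at the origin, which replaces \<open>\<rho>\<close>
  by \<open>- \<rho>\<close>; the terms \<open>\<plusminus> \<rho> \<pi> / 4\<close> of the two half lines then cancel.\<close>

lemma nn_integral_arcsin_line:
  fixes \<rho> :: real
  assumes \<rho>: "\<bar>\<rho>\<bar> < 1"
  defines "c \<equiv> sqrt (1 - \<rho>\<^sup>2)"
  shows "(\<integral>\<^sup>+t. ennreal (\<bar>\<rho> + c * t\<bar> / (1 + t\<^sup>2)\<^sup>2) \<partial>lborel) = ennreal (\<rho> * arcsin \<rho> + c)"
proof -
  have c: "c > 0"
    using \<rho> by (simp add: c_def abs_square_less_1)
  define h where "h r t = ennreal ((r + c * t) / (1 + t\<^sup>2)\<^sup>2) * indicator {- r / c..} t" for r t :: real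
  have [measurable]: "h r \<in> borel_measurable borel" for r
    unfolding h_def by measurable
  have h: "(\<integral>\<^sup>+t. h \<rho> t \<partial>lborel) = ennreal (\<rho> * pi / 4 + (\<rho> * arcsin \<rho> + c) / 2)"
    "(\<integral>\<^sup>+t. h (-\<rho>) t \<partial>lborel) = ennreal (- \<rho> * pi / 4 + (\<rho> * arcsin \<rho> + c) / 2)"
    using nn_integral_arcsin_half_line(2)[of \<rho>] nn_integral_arcsin_half_line(2)[of "-\<rho>"] \<rho>
    unfolding h_def c_def by (auto simp: arcsin_minus)
  have split: "ennreal (\<bar>\<rho> + c * t\<bar> / (1 + t\<^sup>2)\<^sup>2) = h \<rho> t + h (-\<rho>) (0 + (-1) * t)" for t
  proof (cases "- \<rho> / c < t")
    case True
    with c show ?thesis by (simp add: h_def indicator_def field_simps)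
  next
    case False
    then show ?thesis
    proof (cases "- \<rho> / c = t")
      case True
      with c show ?thesis by (auto simp: h_def indicator_def)
    next
      case False
      with \<open>\<not> - \<rho> / c < t\<close> have "t < - \<rho> / c" by simp
      with c show ?thesis by (simp add: h_def indicator_def field_simps)
    qed
  qed
  have nonneg: "0 \<le> \<rho> * pi / 4 + (\<rho> * arcsin \<rho> + c) / 2" "0 \<le> - \<rho> * pi / 4 + (\<rho> * arcsin \<rho> + c) / 2"
    using nn_integral_arcsin_half_line(1)[of \<rho>] nn_integral_arcsin_half_line(1)[of "-\<rho>"] \<rho>
    unfolding c_def by (auto simp: arcsin_minus)
  have "(\<integral>\<^sup>+t. ennreal (\<bar>\<rho> + c * t\<bar> / (1 + t\<^sup>2)\<^sup>2) \<partial>lborel) =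
    (\<integral>\<^sup>+t. h \<rho> t \<partial>lborel) + (\<integral>\<^sup>+t. h (-\<rho>) (0 + (-1) * t) \<partial>lborel)"
    unfolding split by (rule nn_integral_add) simp_all
  also have "(\<integral>\<^sup>+t. h (-\<rho>) (0 + (-1) * t) \<partial>lborel) = (\<integral>\<^sup>+t. h (-\<rho>) t \<partial>lborel)"
    by (subst (2) nn_integral_real_affine[where c="-1" and t=0]) simp_all
  finally show ?thesis
    unfolding h by (subst (asm) ennreal_plus[symmetric]) (use nonneg in simp_all)
qed

text \<open>Both factors are homogeneous of degree one in \<open>(x, y)\<close>, so the slope \<open>t = y / x\<close> separates
  the variables: together with the Jacobian \<open>\<bar>x\<bar>\<close> the integrand becomes \<open>\<bar>x\<bar>\<^sup>3\<close> times a Gaussian in \<open>x\<close>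
  times \<open>\<bar>\<rho> + c t\<bar>\<close>.\<close>

lemma std_normal_abs_product_moment:
  fixes \<rho> :: real
  assumes \<rho>: "\<bar>\<rho>\<bar> < 1"
  defines "c \<equiv> sqrt (1 - \<rho>\<^sup>2)"
  shows "(\<integral>\<^sup>+x. \<integral>\<^sup>+y. ennreal (\<bar>x\<bar> * \<bar>\<rho> * x + c * y\<bar>) \<partial>std_normal \<partial>std_normal) =
         ennreal (2 / pi * (\<rho> * arcsin \<rho> + c))"
proof -
  let ?f = "\<lambda>x y. std_normal_density x * std_normal_density y * (\<bar>x\<bar> * \<bar>\<rho> * x + c * y\<bar>)"
  let ?g = "\<lambda>x t. \<bar>x\<bar> ^ 3 * (std_normal_density x * std_normal_density (x * t)) * \<bar>\<rho> + c * t\<bar>"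
  have slope: "(\<integral>\<^sup>+y. ennreal (?f x y) \<partial>lborel) = (\<integral>\<^sup>+t. ennreal (?g x t) \<partial>lborel)" if "x \<noteq> 0" for x
  proof -
    have "\<bar>x\<bar> * ?f x (0 + x * t) = ?g x t" for t
    proof -
      have "\<rho> * x + c * (0 + x * t) = x * (\<rho> + c * t)"
        by (simp add: algebra_simps)
      then show ?thesis
        by (simp add: abs_mult power3_eq_cube)
    qed
    then have "ennreal \<bar>x\<bar> * ennreal (?f x (0 + x * t)) = ennreal (?g x t)" for t
      by (simp add: ennreal_mult[symmetric])
    then show ?thesis
      using that
      by (subst nn_integral_real_affine[where c=x and t=0]) (simp_all add: nn_integral_cmult[symmetric])
  qed
  have radial: "(\<integral>\<^sup>+x. ennreal (?g x t) \<partial>lborel) = ennreal (2 / pi) * ennreal (\<bar>\<rho> + c * t\<bar> / (1 + t\<^sup>2)\<^sup>2)" for t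
  proof -
    define s where "s = 1 / sqrt (1 + t\<^sup>2)"
    have pos: "1 + t\<^sup>2 > 0"
      by (simp add: add_pos_nonneg)
    then have s: "s > 0" "s\<^sup>2 = 1 / (1 + t\<^sup>2)"
      by (simp_all add: s_def power_divide)
    \<comment> \<open>Along a line of slope \<open>t\<close> the planar density is proportional to a centred normal density of variance \<open>1 / (1 + t\<^sup>2)\<close>.\<close>
    have dens: "std_normal_density x * std_normal_density (x * t) = s / sqrt (2 * pi) * normal_density 0 s x" for x
    proof -
      have "- x\<^sup>2 / 2 + - (x * t)\<^sup>2 / 2 = - (x - 0)\<^sup>2 / (2 * s\<^sup>2)"
        unfolding s(2) by (simp add: field_simps)
      then have "exp (- x\<^sup>2 / 2) * exp (- (x * t)\<^sup>2 / 2) = exp (- (x - 0)\<^sup>2 / (2 * s\<^sup>2))"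
        by (simp only: exp_add[symmetric])
      then show ?thesis
        using s(1) by (simp add: normal_density_def real_sqrt_mult field_simps)
    qed
    have "(\<integral>\<^sup>+x. ennreal (?g x t) \<partial>lborel) =
       (\<integral>\<^sup>+x. ennreal (s / sqrt (2 * pi) * \<bar>\<rho> + c * t\<bar>) * ennreal (normal_density 0 s x * \<bar>x\<bar> ^ 3) \<partial>lborel)"
      using s by (intro nn_integral_cong) (simp add: dens ennreal_mult[symmetric] mult_ac)
    also have "\<dots> = ennreal (s / sqrt (2 * pi) * \<bar>\<rho> + c * t\<bar>) * ennreal (2 * s ^ 3 * sqrt (2 / pi))"
      using normal_moment_abs_odd[OF s(1), of 0 1]
      by (subst nn_integral_cmult, simp, subst nn_integral_eq_integral)
         (auto simp: has_bochner_integral_iff numeral_3_eq_3 numeral_2_eq_2)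
    also have "\<dots> = ennreal (2 / pi) * ennreal (\<bar>\<rho> + c * t\<bar> / (1 + t\<^sup>2)\<^sup>2)"
    proof -
      have "s / sqrt (2 * pi) * \<bar>\<rho> + c * t\<bar> * (2 * s ^ 3 * sqrt (2 / pi)) = 2 / pi * \<bar>\<rho> + c * t\<bar> * (s\<^sup>2)\<^sup>2"
        by (simp add: real_sqrt_mult real_sqrt_divide power2_eq_square power3_eq_cube)
      then show ?thesis
        using s by (simp add: ennreal_mult[symmetric] power_divide)
    qed
    finally show ?thesis .
  qed
  have "(\<integral>\<^sup>+x. \<integral>\<^sup>+y. ennreal (\<bar>x\<bar> * \<bar>\<rho> * x + c * y\<bar>) \<partial>std_normal \<partial>std_normal) =
        (\<integral>\<^sup>+x. \<integral>\<^sup>+y. ennreal (?f x y) \<partial>lborel \<partial>lborel)"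
    using nn_integral_std_normal_pair[of "\<lambda>(x, y). ennreal (\<bar>x\<bar> * \<bar>\<rho> * x + c * y\<bar>)"]
    by (simp add: ennreal_mult')
  also have "\<dots> = (\<integral>\<^sup>+x. \<integral>\<^sup>+t. ennreal (?g x t) \<partial>lborel \<partial>lborel)"
    using AE_lborel_singleton[of "0::real"] by (intro nn_integral_cong_AE) (auto simp: slope)
  also have "\<dots> = (\<integral>\<^sup>+t. \<integral>\<^sup>+x. ennreal (?g x t) \<partial>lborel \<partial>lborel)"
    by (rule lborel_pair.Fubini'[symmetric]) simp
  also have "\<dots> = ennreal (2 / pi) * ennreal (\<rho> * arcsin \<rho> + c)"
    unfolding radial using nn_integral_arcsin_line[OF \<rho>]
    by (subst nn_integral_cmult) (simp_all add: c_def)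
  finally show ?thesis
    by (simp only: ennreal_mult'[symmetric] zero_le_divide_iff zero_le_numeral pi_ge_zero simp_thms)
qed

section \<open>Reduction of the bivariate normal law to independent variables\<close>

text \<open>The quadratic form in the exponent becomes \<open>u\<^sup>2 + v\<^sup>2\<close> under the triangular substitution
  \<open>x = m1 + s1 u\<close>, \<open>y = m2 + s2 (\<theta> u + c v)\<close>, whose Jacobian \<open>s1 s2 c\<close> cancels the normalising
  constant up to the factor \<open>2 \<pi>\<close> of the two standard normal densities.\<close>

lemma nn_integral_bivariate_normal:
  fixes m1 m2 s1 s2 \<theta> :: real
  assumes s: "s1 > 0" "s2 > 0" and \<theta>: "\<bar>\<theta>\<bar> < 1"
    and f[measurable]: "f \<in> borel_measurable (borel \<Otimes>\<^sub>M borel)"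
  shows "(\<integral>\<^sup>+p. f p \<partial>density (lborel \<Otimes>\<^sub>M lborel) (\<lambda>p. ennreal (bivariate_normal_density m1 m2 s1 s2 \<theta> p))) =
    (\<integral>\<^sup>+u. \<integral>\<^sup>+v. f (m1 + s1 * u, m2 + s2 * (\<theta> * u + sqrt (1 - \<theta>\<^sup>2) * v)) \<partial>std_normal \<partial>std_normal)"
proof -
  define c where "c = sqrt (1 - \<theta>\<^sup>2)"
  have c: "c > 0" "c\<^sup>2 = 1 - \<theta>\<^sup>2"
    using \<theta> by (simp_all add: c_def abs_square_less_1 less_imp_le)
  let ?d = "bivariate_normal_density m1 m2 s1 s2 \<theta>"
  let ?H = "\<lambda>x y. ennreal (?d (x, y)) * f (x, y)"
  let ?x = "\<lambda>u. m1 + s1 * u"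
  let ?y = "\<lambda>u v. (m2 + s2 * \<theta> * u) + (s2 * c) * v"
  have [measurable]: "?d \<in> borel_measurable (borel \<Otimes>\<^sub>M borel)"
    unfolding bivariate_normal_density_def by measurable
  have dens: "s1 * ((s2 * c) * ?d (?x u, ?y u v)) = std_normal_density u * std_normal_density v" for u v
  proof -
    have y: "?y u v - m2 = s2 * (\<theta> * u + c * v)"
      by (simp add: algebra_simps)
    have "(?x u - m1)\<^sup>2 / s1\<^sup>2 - 2 * \<theta> * (?x u - m1) * (?y u v - m2) / (s1 * s2) + (?y u v - m2)\<^sup>2 / s2\<^sup>2
       = u\<^sup>2 - 2 * \<theta> * u * (\<theta> * u + c * v) + (\<theta> * u + c * v)\<^sup>2"
      unfolding y using s by (simp add: power_mult_distrib)
    also have "\<dots> = (1 - \<theta>\<^sup>2) * u\<^sup>2 + c\<^sup>2 * v\<^sup>2"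
      by (simp add: power2_eq_square algebra_simps)
    also have "\<dots> = c\<^sup>2 * (u\<^sup>2 + v\<^sup>2)"
      unfolding c(2) by (simp add: algebra_simps)
    finally have "?d (?x u, ?y u v) = 1 / (2 * pi * s1 * s2 * c) * exp (- 1 / (2 * c\<^sup>2) * (c\<^sup>2 * (u\<^sup>2 + v\<^sup>2)))"
      unfolding bivariate_normal_density_def prod.case c_def[symmetric]
      unfolding c(2)[symmetric] by (simp only:)
    also have "- 1 / (2 * c\<^sup>2) * (c\<^sup>2 * (u\<^sup>2 + v\<^sup>2)) = - u\<^sup>2 / 2 + - v\<^sup>2 / 2"
      using c(1) by (simp add: field_simps)
    finally show ?thesis
      unfolding exp_add using s c(1) by (simp add: std_normal_density_def)
  qed
  have "(\<integral>\<^sup>+p. f p \<partial>density (lborel \<Otimes>\<^sub>M lborel) (\<lambda>p. ennreal (?d p))) =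
    (\<integral>\<^sup>+x. \<integral>\<^sup>+y. ?H x y \<partial>lborel \<partial>lborel)"
    by (simp add: nn_integral_density lborel.nn_integral_fst[symmetric])
  also have "\<dots> = ennreal s1 * (\<integral>\<^sup>+u. \<integral>\<^sup>+y. ?H (?x u) y \<partial>lborel \<partial>lborel)"
    using s by (subst nn_integral_real_affine[where c=s1 and t=m1]) simp_all
  also have "(\<lambda>u. \<integral>\<^sup>+y. ?H (?x u) y \<partial>lborel) = (\<lambda>u. ennreal (s2 * c) * (\<integral>\<^sup>+v. ?H (?x u) (?y u v) \<partial>lborel))"
  proof
    fix u
    show "(\<integral>\<^sup>+y. ?H (?x u) y \<partial>lborel) = ennreal (s2 * c) * (\<integral>\<^sup>+v. ?H (?x u) (?y u v) \<partial>lborel)"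
      using s c by (subst nn_integral_real_affine[where c="s2 * c" and t="m2 + s2 * \<theta> * u"]) simp_all
  qed
  also have "ennreal s1 * (\<integral>\<^sup>+u. ennreal (s2 * c) * (\<integral>\<^sup>+v. ?H (?x u) (?y u v) \<partial>lborel) \<partial>lborel) =
     (\<integral>\<^sup>+u. \<integral>\<^sup>+v. ennreal s1 * (ennreal (s2 * c) * ?H (?x u) (?y u v)) \<partial>lborel \<partial>lborel)"
    by (simp add: nn_integral_cmult)
  also have "\<dots> = (\<integral>\<^sup>+u. \<integral>\<^sup>+v. ennreal (std_normal_density u * std_normal_density v) * f (?x u, ?y u v) \<partial>lborel \<partial>lborel)"
    unfolding dens[symmetric]
    using s c by (simp add: ennreal_mult' mult.assoc)
  also have "\<dots> = (\<integral>\<^sup>+u. \<integral>\<^sup>+v. f (?x u, ?y u v) \<partial>std_normal \<partial>std_normal)"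
    using nn_integral_std_normal_pair[of "\<lambda>(u, v). f (?x u, ?y u v)"] by simp
  finally show ?thesis
    by (simp add: c_def algebra_simps)
qed

section \<open>Moments of differences of copies\<close>

lemma std_normal_abs_diff:
  "(\<integral>\<^sup>+u. \<integral>\<^sup>+u'. ennreal \<bar>u - u'\<bar> \<partial>std_normal \<partial>std_normal) = ennreal (2 / sqrt pi)"
proof -
  have "(\<integral>\<^sup>+u. \<integral>\<^sup>+u'. ennreal \<bar>u - u'\<bar> \<partial>std_normal \<partial>std_normal) =
      (\<integral>\<^sup>+x. ennreal (sqrt 2) * ennreal \<bar>x\<bar> \<partial>std_normal)"
    using std_normal_linear_combination[of "\<lambda>x. ennreal \<bar>x\<bar>" 1 "-1"]
    by (simp add: abs_mult ennreal_mult)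
  also have "\<dots> = ennreal (2 / sqrt pi)"
    by (subst nn_integral_cmult)
      (simp_all add: std_normal_abs_moment ennreal_mult[symmetric] real_sqrt_divide)
  finally show ?thesis .
qed

text \<open>Dividing both differences \<open>u1 - u2\<close> and \<open>v1 - v2\<close> by \<open>sqrt 2\<close> gives two independent standard normal
  variables, so this is twice the absolute product moment for the correlation \<open>\<theta>\<close>.\<close>

lemma std_normal_diffs_two_copies:
  fixes \<theta> :: real
  assumes \<theta>: "\<bar>\<theta>\<bar> < 1"
  defines "c \<equiv> sqrt (1 - \<theta>\<^sup>2)"
  shows "(\<integral>\<^sup>+u1. \<integral>\<^sup>+v1. \<integral>\<^sup>+u2. \<integral>\<^sup>+v2. ennreal (\<bar>u1 - u2\<bar> * \<bar>(\<theta> * u1 + c * v1) - (\<theta> * u2 + c * v2)\<bar>)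
            \<partial>std_normal \<partial>std_normal \<partial>std_normal \<partial>std_normal) =
         ennreal (4 / pi * (\<theta> * arcsin \<theta> + c))"
proof -
  let ?k = "\<lambda>x y. ennreal (\<bar>x\<bar> * \<bar>\<theta> * x + c * y\<bar>)"
  have eq: "ennreal (\<bar>u1 - u2\<bar> * \<bar>(\<theta> * u1 + c * v1) - (\<theta> * u2 + c * v2)\<bar>) = ?k (1 * u1 + (-1) * u2) (1 * v1 + (-1) * v2)"
    for u1 u2 v1 v2 :: real
    by (simp add: algebra_simps)
  have scale: "?k (sqrt 2 * x) (sqrt 2 * y) = ennreal 2 * ?k x y" for x y
  proof -
    have "\<bar>sqrt 2 * x\<bar> * \<bar>\<theta> * (sqrt 2 * x) + c * (sqrt 2 * y)\<bar> = \<bar>sqrt 2 * x\<bar> * \<bar>sqrt 2 * (\<theta> * x + c * y)\<bar>"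
      by (simp add: algebra_simps)
    also have "\<dots> = 2 * (\<bar>x\<bar> * \<bar>\<theta> * x + c * y\<bar>)"
      by (simp add: abs_mult)
    finally show ?thesis
      by (simp only: ennreal_mult'[symmetric] zero_le_numeral)
  qed
  have "(\<integral>\<^sup>+u1. \<integral>\<^sup>+v1. \<integral>\<^sup>+u2. \<integral>\<^sup>+v2. ?k (1 * u1 + (-1) * u2) (1 * v1 + (-1) * v2)
            \<partial>std_normal \<partial>std_normal \<partial>std_normal \<partial>std_normal) =
        (\<integral>\<^sup>+u1. \<integral>\<^sup>+u2. \<integral>\<^sup>+v1. \<integral>\<^sup>+v2. ?k (1 * u1 + (-1) * u2) (1 * v1 + (-1) * v2)
            \<partial>std_normal \<partial>std_normal \<partial>std_normal \<partial>std_normal)"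
    by (intro nn_integral_cong std_normal_swap) measurable
  also have "\<dots> = (\<integral>\<^sup>+u1. \<integral>\<^sup>+u2. \<integral>\<^sup>+y. ?k (1 * u1 + (-1) * u2) (sqrt 2 * y)
            \<partial>std_normal \<partial>std_normal \<partial>std_normal)"
  proof -
    have "(\<integral>\<^sup>+v1. \<integral>\<^sup>+v2. ?k x (1 * v1 + (-1) * v2) \<partial>std_normal \<partial>std_normal) =
        (\<integral>\<^sup>+y. ?k x (sqrt 2 * y) \<partial>std_normal)" for x
      using std_normal_linear_combination[of "?k x" 1 "-1"] by simp
    then show ?thesis by (simp only:)
  qed
  also have "\<dots> = (\<integral>\<^sup>+x. \<integral>\<^sup>+y. ?k (sqrt 2 * x) (sqrt 2 * y) \<partial>std_normal \<partial>std_normal)"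
    by (subst std_normal_linear_combination[where f="\<lambda>x. \<integral>\<^sup>+y. ?k x (sqrt 2 * y) \<partial>std_normal"]) simp_all
  also have "\<dots> = ennreal 2 * (\<integral>\<^sup>+x. \<integral>\<^sup>+y. ?k x y \<partial>std_normal \<partial>std_normal)"
    unfolding scale by (simp add: nn_integral_cmult)
  also have "\<dots> = ennreal (4 / pi * (\<theta> * arcsin \<theta> + c))"
    using std_normal_abs_product_moment[OF \<theta>] unfolding c_def
    by (simp only: ennreal_mult'[symmetric] zero_le_numeral) simp
  finally show ?thesis
    unfolding eq .
qed

text \<open>Here the two differences share only the first copy. The variables are eliminated in turn:
  \<open>u3, v3\<close> and then \<open>v1\<close> are merged into one independent normal variable, and the rotation of \<open>(u1, u2)\<close> by an
  eighth turn makes \<open>u1 - u2\<close> a multiple \<open>sqrt 2 p\<close> of one coordinate. The other coordinate \<open>q\<close> only contributes to the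
  independent part, whose variance is then \<open>2 - \<theta>\<^sup>2 / 2 = 2 (1 - (\<theta> / 2)\<^sup>2)\<close>; this is twice the absolute
  product moment for the correlation \<open>\<theta> / 2\<close>.\<close>

lemma std_normal_diffs_three_copies:
  fixes \<theta> :: real
  assumes \<theta>: "\<bar>\<theta>\<bar> < 1"
  defines "c \<equiv> sqrt (1 - \<theta>\<^sup>2)"
  shows "(\<integral>\<^sup>+u1. \<integral>\<^sup>+v1. \<integral>\<^sup>+u2. \<integral>\<^sup>+u3. \<integral>\<^sup>+v3. ennreal (\<bar>u1 - u2\<bar> * \<bar>(\<theta> * u1 + c * v1) - (\<theta> * u3 + c * v3)\<bar>)
            \<partial>std_normal \<partial>std_normal \<partial>std_normal \<partial>std_normal \<partial>std_normal) =
         ennreal (2 / pi * (\<theta> * arcsin (\<theta> / 2) + sqrt (4 - \<theta>\<^sup>2)))"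
proof -
  define d where "d = sqrt (c\<^sup>2 + 1)"
  define e where "e = sqrt (1 - (\<theta> / 2)\<^sup>2)"
  have \<theta>2: "\<theta>\<^sup>2 < 1"
    using \<theta> by (simp add: abs_square_less_1)
  have c2: "c\<^sup>2 = 1 - \<theta>\<^sup>2" and d2: "d\<^sup>2 = 2 - \<theta>\<^sup>2"
    using \<theta>2 by (simp_all add: c_def d_def)
  have e4: "2 * e = sqrt (4 - \<theta>\<^sup>2)"
  proof -
    have "2 * e = sqrt 4 * e" by simp
    also have "\<dots> = sqrt (4 * (1 - (\<theta> / 2)\<^sup>2))" unfolding e_def real_sqrt_mult ..
    finally show ?thesis by (simp add: power_divide)
  qed
  let ?k = "\<lambda>x y. ennreal (\<bar>x\<bar> * \<bar>y\<bar>)"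
  have eq: "ennreal (\<bar>u1 - u2\<bar> * \<bar>(\<theta> * u1 + c * v1) - (\<theta> * u3 + c * v3)\<bar>) =
      ?k (u1 - u2) (\<theta> * u1 + c * v1 + ((-\<theta>) * u3 + (-c) * v3))"
    for u1 u2 u3 v1 v3 :: real
    by (simp add: algebra_simps)
  have "(\<integral>\<^sup>+u1. \<integral>\<^sup>+v1. \<integral>\<^sup>+u2. \<integral>\<^sup>+u3. \<integral>\<^sup>+v3. ?k (u1 - u2) (\<theta> * u1 + c * v1 + ((-\<theta>) * u3 + (-c) * v3))
            \<partial>std_normal \<partial>std_normal \<partial>std_normal \<partial>std_normal \<partial>std_normal) =
        (\<integral>\<^sup>+u1. \<integral>\<^sup>+v1. \<integral>\<^sup>+u2. \<integral>\<^sup>+w. ?k (u1 - u2) (\<theta> * u1 + (c * v1 + 1 * w))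
            \<partial>std_normal \<partial>std_normal \<partial>std_normal \<partial>std_normal)"
  proof -
    have "(\<integral>\<^sup>+u3. \<integral>\<^sup>+v3. ?k (u1 - u2) (\<theta> * u1 + c * v1 + ((-\<theta>) * u3 + (-c) * v3)) \<partial>std_normal \<partial>std_normal) =
      (\<integral>\<^sup>+w. ?k (u1 - u2) (\<theta> * u1 + (c * v1 + 1 * w)) \<partial>std_normal)" for u1 v1 u2
      using std_normal_linear_combination[of "\<lambda>z. ?k (u1 - u2) (\<theta> * u1 + c * v1 + z)" "-\<theta>" "-c"]
      by (simp add: c2 add.assoc)
    then show ?thesis by (simp only:)
  qed
  also have "\<dots> = (\<integral>\<^sup>+u1. \<integral>\<^sup>+u2. \<integral>\<^sup>+v1. \<integral>\<^sup>+w. ?k (u1 - u2) (\<theta> * u1 + (c * v1 + 1 * w))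
            \<partial>std_normal \<partial>std_normal \<partial>std_normal \<partial>std_normal)"
    by (intro nn_integral_cong std_normal_swap) measurable
  also have "\<dots> = (\<integral>\<^sup>+u1. \<integral>\<^sup>+u2. \<integral>\<^sup>+y. ?k (u1 - u2) (\<theta> * u1 + d * y) \<partial>std_normal \<partial>std_normal \<partial>std_normal)"
  proof -
    have "(\<integral>\<^sup>+v1. \<integral>\<^sup>+w. ?k (u1 - u2) (\<theta> * u1 + (c * v1 + 1 * w)) \<partial>std_normal \<partial>std_normal) =
      (\<integral>\<^sup>+y. ?k (u1 - u2) (\<theta> * u1 + d * y) \<partial>std_normal)" for u1 u2
      using std_normal_linear_combination[of "\<lambda>z. ?k (u1 - u2) (\<theta> * u1 + z)" c 1]
      by (simp add: d_def)
    then show ?thesis by (simp only:)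
  qed
  also have "\<dots> = (\<integral>\<^sup>+p. \<integral>\<^sup>+q. \<integral>\<^sup>+y. ?k (sqrt 2 * p) (sqrt 2 * (\<theta> / 2) * p + (sqrt 2 * (\<theta> / 2) * q + d * y)) \<partial>std_normal \<partial>std_normal \<partial>std_normal)"
  proof -
    \<comment> \<open>The rotated coordinates are \<open>p = h (u1 - u2)\<close> and \<open>q = h (u1 + u2)\<close>, so that \<open>u1 = h (p + q)\<close>.\<close>
    define h :: real where "h = 1 / sqrt 2"
    have h: "sqrt 2 * h = 1" "h\<^sup>2 + (- h)\<^sup>2 = 1" "h \<noteq> 0"
      by (simp_all add: h_def power_divide)
    let ?G = "\<lambda>p q. \<integral>\<^sup>+y. ?k (sqrt 2 * p) (sqrt 2 * (\<theta> / 2) * p + (sqrt 2 * (\<theta> / 2) * q + d * y)) \<partial>std_normal"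
    have "(\<integral>\<^sup>+y. ?k (x - z) (\<theta> * x + d * y) \<partial>std_normal) = ?G (h * x + (- h) * z) (h * z - (- h) * x)" for x z
    proof -
      have "sqrt 2 * (\<theta> / 2) * (h * x + (- h) * z) + (sqrt 2 * (\<theta> / 2) * (h * z - (- h) * x) + d * y) =
            (sqrt 2 * h) * (\<theta> * x) + d * y" for y
        by (simp add: field_simps)
      moreover have "sqrt 2 * (h * x + (- h) * z) = (sqrt 2 * h) * (x - z)"
        by (simp add: algebra_simps)
      ultimately show ?thesis
        by (simp only: h(1) mult_1_left add.assoc)
    qed
    moreover have "(\<lambda>p. ?G (fst p) (snd p)) \<in> borel_measurable (borel \<Otimes>\<^sub>M borel)"
      by measurable
    ultimately show ?thesis
      using std_normal_rotate[of h "- h" "\<lambda>p. ?G (fst p) (snd p)", OF h(2,3)]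
      by (simp only: fst_conv snd_conv)
  qed
  also have "\<dots> = (\<integral>\<^sup>+p. \<integral>\<^sup>+z. ?k (sqrt 2 * p) (sqrt 2 * (\<theta> / 2) * p + sqrt 2 * e * z) \<partial>std_normal \<partial>std_normal)"
  proof -
    have "sqrt ((sqrt 2 * (\<theta> / 2))\<^sup>2 + d\<^sup>2) = sqrt (2 * (1 - (\<theta> / 2)\<^sup>2))"
      unfolding d2 by (simp add: power_mult_distrib power_divide)
    also have "\<dots> = sqrt 2 * e"
      unfolding e_def real_sqrt_mult ..
    finally have *: "sqrt ((sqrt 2 * (\<theta> / 2))\<^sup>2 + d\<^sup>2) = sqrt 2 * e" .
    show ?thesis
    proof -
      have "(\<integral>\<^sup>+q. \<integral>\<^sup>+y. ?k (sqrt 2 * p) (sqrt 2 * (\<theta> / 2) * p + (sqrt 2 * (\<theta> / 2) * q + d * y)) \<partial>std_normal \<partial>std_normal) =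
        (\<integral>\<^sup>+z. ?k (sqrt 2 * p) (sqrt 2 * (\<theta> / 2) * p + sqrt 2 * e * z) \<partial>std_normal)" for p
        using std_normal_linear_combination[of "\<lambda>z. ?k (sqrt 2 * p) (sqrt 2 * (\<theta> / 2) * p + z)" "sqrt 2 * (\<theta> / 2)" d]
        unfolding * by simp
      then show ?thesis by (simp only:)
    qed
  qed
  also have "\<dots> = (\<integral>\<^sup>+p. \<integral>\<^sup>+z. ennreal 2 * ennreal (\<bar>p\<bar> * \<bar>\<theta> / 2 * p + e * z\<bar>) \<partial>std_normal \<partial>std_normal)"
  proof -
    have "\<bar>sqrt 2 * p\<bar> * \<bar>sqrt 2 * (\<theta> / 2) * p + sqrt 2 * e * z\<bar> = \<bar>sqrt 2 * p\<bar> * \<bar>sqrt 2 * (\<theta> / 2 * p + e * z)\<bar>" for p z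
      by (simp add: algebra_simps)
    also have "\<bar>sqrt 2 * p\<bar> * \<bar>sqrt 2 * (\<theta> / 2 * p + e * z)\<bar> = 2 * (\<bar>p\<bar> * \<bar>\<theta> / 2 * p + e * z\<bar>)" for p z
      by (simp add: abs_mult)
    finally show ?thesis
      by (simp only: ennreal_mult'[symmetric] zero_le_numeral)
  qed
  also have "\<dots> = ennreal 2 * (\<integral>\<^sup>+p. \<integral>\<^sup>+z. ennreal (\<bar>p\<bar> * \<bar>\<theta> / 2 * p + e * z\<bar>) \<partial>std_normal \<partial>std_normal)"
    by (simp add: nn_integral_cmult)
  also have "\<dots> = ennreal (2 / pi * (\<theta> * arcsin (\<theta> / 2) + 2 * e))"
  proof -
    have "(\<integral>\<^sup>+p. \<integral>\<^sup>+z. ennreal (\<bar>p\<bar> * \<bar>\<theta> / 2 * p + e * z\<bar>) \<partial>std_normal \<partial>std_normal) =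
        ennreal (2 / pi * (\<theta> / 2 * arcsin (\<theta> / 2) + e))"
      using std_normal_abs_product_moment[of "\<theta> / 2"] \<theta> unfolding e_def by linarith
    moreover have "2 * (2 / pi * (\<theta> / 2 * arcsin (\<theta> / 2) + e)) = 2 / pi * (\<theta> * arcsin (\<theta> / 2) + 2 * e)"
      by (simp add: field_simps)
    ultimately show ?thesis
      by (simp only: ennreal_mult'[symmetric] zero_le_numeral)
  qed
  finally show ?thesis
    unfolding eq e4 .
qed

section \<open>Moments of bivariate normal copies\<close>

lemma square_integrable_std_normal: "square_integrable std_normal (\<lambda>x. x)"
proof -
  have "integrable lborel (\<lambda>x. std_normal_density x * x\<^sup>2)"
    by (rule integrable_std_normal_moment)
  then show ?thesis
    by (simp add: square_integrable_def integrable_density)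
qed

lemma arcsin_times_self_nonneg:
  fixes x :: real
  assumes "\<bar>x\<bar> \<le> 1"
  shows "0 \<le> x * arcsin x"
proof (cases "0 \<le> x")
  case True
  with assms arcsin_le_arcsin[of 0 x] show ?thesis by simp
next
  case False
  with assms arcsin_le_arcsin[of x 0] show ?thesis by (simp add: mult_nonpos_nonpos)
qed

locale bivariate_normal_pair =
  fixes N :: "'a measure" and X Y :: "'a \<Rightarrow> real" and m1 m2 s1 s2 \<theta> :: real
  assumes prob_N: "prob_space N"
    and normal: "bivariate_normal N X Y m1 m2 s1 s2 \<theta>"
    and s1: "0 < s1" and s2: "0 < s2" and \<theta>: "\<bar>\<theta>\<bar> < 1"
begin

text \<open>The conditional standard deviation of the standardised second variable given the first.\<close>

definition c :: real where "c = sqrt (1 - \<theta>\<^sup>2)"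

abbreviation T :: "real \<Rightarrow> real \<Rightarrow> real \<times> real" where
  "T u v \<equiv> (m1 + s1 * u, m2 + s2 * (\<theta> * u + c * v))"

abbreviation P :: "(real \<times> real) measure" where
  "P \<equiv> distr N (borel \<Otimes>\<^sub>M borel) (\<lambda>\<omega>. (X \<omega>, Y \<omega>))"

lemma \<theta>2: "\<theta>\<^sup>2 < 1"
  using \<theta> by (simp add: abs_square_less_1)

lemma c: "0 < c" "c\<^sup>2 = 1 - \<theta>\<^sup>2"
  using \<theta>2 by (simp_all add: c_def)

lemma joint_measurable: "(\<lambda>\<omega>. (X \<omega>, Y \<omega>)) \<in> measurable N (borel \<Otimes>\<^sub>M borel)"
proof -
  have "(\<lambda>\<omega>. (X \<omega>, Y \<omega>)) \<in> measurable N (lborel \<Otimes>\<^sub>M lborel)"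
    using normal unfolding bivariate_normal_def distributed_def by blast
  also have "measurable N (lborel \<Otimes>\<^sub>M lborel) = measurable N (borel \<Otimes>\<^sub>M borel)"
    by (intro measurable_cong_sets sets_pair_measure_cong refl sets_lborel)
  finally show ?thesis .
qed

lemma measurable_X: "X \<in> borel_measurable N" and measurable_Y: "Y \<in> borel_measurable N"
  using measurable_compose[OF joint_measurable measurable_fst]
    measurable_compose[OF joint_measurable measurable_snd] by simp_all

lemma nn_integral_joint_law:
  assumes "f \<in> borel_measurable (borel \<Otimes>\<^sub>M borel)"
  shows "(\<integral>\<^sup>+p. f p \<partial>P) = (\<integral>\<^sup>+u. \<integral>\<^sup>+v. f (T u v) \<partial>std_normal \<partial>std_normal)"
proof -
  have "P = distr N (lborel \<Otimes>\<^sub>M lborel) (\<lambda>\<omega>. (X \<omega>, Y \<omega>))"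
    by (intro distr_cong sets_pair_measure_cong refl sets_lborel[symmetric])
  also have "\<dots> = density (lborel \<Otimes>\<^sub>M lborel) (\<lambda>p. ennreal (bivariate_normal_density m1 m2 s1 s2 \<theta> p))"
    using normal unfolding bivariate_normal_def distributed_def by blast
  finally show ?thesis
    using nn_integral_bivariate_normal[OF s1 s2 \<theta> assms] by (simp add: c_def)
qed

lemma square_integrable_marginal:
  assumes f[measurable]: "f \<in> borel_measurable (borel \<Otimes>\<^sub>M borel)"
    and L2: "square_integrable (std_normal \<Otimes>\<^sub>M std_normal) (\<lambda>(u, v). f (T u v))"
  shows "square_integrable N (\<lambda>\<omega>. f (X \<omega>, Y \<omega>))"
proof -
  note [measurable] = measurable_X measurable_Y
  have "(\<integral>\<^sup>+\<omega>. ennreal ((f (X \<omega>, Y \<omega>))\<^sup>2) \<partial>N) = (\<integral>\<^sup>+p. ennreal ((f p)\<^sup>2) \<partial>P)"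
    by (subst nn_integral_distr) simp_all
  also have "\<dots> = (\<integral>\<^sup>+u. \<integral>\<^sup>+v. ennreal ((f (T u v))\<^sup>2) \<partial>std_normal \<partial>std_normal)"
    by (rule nn_integral_joint_law) measurable
  also have "\<dots> = (\<integral>\<^sup>+z. ennreal ((case z of (u, v) \<Rightarrow> f (T u v))\<^sup>2) \<partial>(std_normal \<Otimes>\<^sub>M std_normal))"
    by (subst std_normal.nn_integral_fst[symmetric]) simp_all
  also have "\<dots> < \<infinity>"
    using L2 by (simp add: square_integrable_def integrable_iff_bounded)
  finally show ?thesis
    by (simp add: square_integrable_def integrable_iff_bounded)
qed

lemma square_integrable_X: "square_integrable N X"
  and square_integrable_Y: "square_integrable N Y"
proof -
  note closure = square_integrable_add square_integrable_cmult std_normal_pair.P.square_integrable_const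
    std_normal.square_integrable_fst[OF square_integrable_std_normal]
    std_normal.square_integrable_snd[OF square_integrable_std_normal]
  have "square_integrable (std_normal \<Otimes>\<^sub>M std_normal) (\<lambda>z. m1 + s1 * fst z)"
    by (intro closure)
  then show "square_integrable N X"
    using square_integrable_marginal[of fst] by (simp add: case_prod_unfold)
  have "square_integrable (std_normal \<Otimes>\<^sub>M std_normal) (\<lambda>z. m2 + s2 * (\<theta> * fst z + c * snd z))"
    by (intro closure)
  then show "square_integrable N Y"
    using square_integrable_marginal[of snd] by (simp add: case_prod_unfold)
qed

end

locale bivariate_normal_copies = bivariate_normal_pair N X Y m1 m2 s1 s2 \<theta>
  for N :: "'a measure" and X Y :: "'a \<Rightarrow> real" and m1 m2 s1 s2 \<theta> :: real +
  fixes M :: "'b measure" and X' Y' :: "'i \<Rightarrow> 'b \<Rightarrow> real" and I :: "'i set" and i j k :: 'i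
  assumes prob_M: "prob_space M"
    and copies: "iid_copies N X Y M X' Y' I"
    and ijk: "i \<in> I" "j \<in> I" "k \<in> I" "i \<noteq> j" "i \<noteq> k" "j \<noteq> k"
begin

lemma measurable_copies:
  "l \<in> I \<Longrightarrow> X' l \<in> borel_measurable M" "l \<in> I \<Longrightarrow> Y' l \<in> borel_measurable M"
proof -
  interpret M: prob_space M by (rule prob_M)
  assume "l \<in> I"
  then have *: "(\<lambda>\<omega>. (X' l \<omega>, Y' l \<omega>)) \<in> measurable M (borel \<Otimes>\<^sub>M borel)"
    using copies unfolding iid_copies_def M.indep_vars_def by blast
  show "X' l \<in> borel_measurable M" "Y' l \<in> borel_measurable M"
    using measurable_compose[OF * measurable_fst] measurable_compose[OF * measurable_snd] by simp_all
qed

lemma nn_integral_copies: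
  assumes F[measurable]: "F \<in> borel_measurable ((borel \<Otimes>\<^sub>M borel) \<Otimes>\<^sub>M (borel \<Otimes>\<^sub>M borel) \<Otimes>\<^sub>M (borel \<Otimes>\<^sub>M borel))"
  shows "(\<integral>\<^sup>+\<omega>. F ((X' i \<omega>, Y' i \<omega>), (X' j \<omega>, Y' j \<omega>), (X' k \<omega>, Y' k \<omega>)) \<partial>M) =
    (\<integral>\<^sup>+u1. \<integral>\<^sup>+v1. \<integral>\<^sup>+u2. \<integral>\<^sup>+v2. \<integral>\<^sup>+u3. \<integral>\<^sup>+v3. F (T u1 v1, T u2 v2, T u3 v3)
      \<partial>std_normal \<partial>std_normal \<partial>std_normal \<partial>std_normal \<partial>std_normal \<partial>std_normal)"
proof -
  interpret N: prob_space N by (rule prob_N)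
  interpret P: prob_space P
    by (rule N.prob_space_distr[OF joint_measurable])
  have "(\<integral>\<^sup>+\<omega>. F ((X' i \<omega>, Y' i \<omega>), (X' j \<omega>, Y' j \<omega>), (X' k \<omega>, Y' k \<omega>)) \<partial>M) =
    (\<integral>\<^sup>+p. \<integral>\<^sup>+q. \<integral>\<^sup>+r. F (p, q, r) \<partial>P \<partial>P \<partial>P)"
    by (rule nn_integral_iid_copies[OF prob_N prob_M measurable_X measurable_Y copies ijk F])
  also have "\<dots> = (\<integral>\<^sup>+u1. \<integral>\<^sup>+v1. \<integral>\<^sup>+q. \<integral>\<^sup>+r. F (T u1 v1, q, r) \<partial>P \<partial>P \<partial>std_normal \<partial>std_normal)"
    by (rule nn_integral_joint_law) measurable
  also have "\<dots> = (\<integral>\<^sup>+u1. \<integral>\<^sup>+v1. \<integral>\<^sup>+u2. \<integral>\<^sup>+v2. \<integral>\<^sup>+r. F (T u1 v1, T u2 v2, r)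
      \<partial>P \<partial>std_normal \<partial>std_normal \<partial>std_normal \<partial>std_normal)"
    by (intro nn_integral_cong nn_integral_joint_law) measurable
  also have "\<dots> = (\<integral>\<^sup>+u1. \<integral>\<^sup>+v1. \<integral>\<^sup>+u2. \<integral>\<^sup>+v2. \<integral>\<^sup>+u3. \<integral>\<^sup>+v3. F (T u1 v1, T u2 v2, T u3 v3)
      \<partial>std_normal \<partial>std_normal \<partial>std_normal \<partial>std_normal \<partial>std_normal \<partial>std_normal)"
    by (intro nn_integral_cong nn_integral_joint_law) measurable
  finally show ?thesis .
qed

lemma abs_diff_T:
  "\<bar>fst (T u v) - fst (T u' v')\<bar> = s1 * \<bar>u - u'\<bar>"
  "\<bar>snd (T u v) - snd (T u' v')\<bar> = s2 * \<bar>(\<theta> * u + c * v) - (\<theta> * u' + c * v')\<bar>"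
  using s1 s2 by (simp_all add: abs_mult flip: right_diff_distrib)

lemma mean_abs_diff_X: "(\<integral>\<omega>. \<bar>X' i \<omega> - X' j \<omega>\<bar> \<partial>M) = 2 * s1 / sqrt pi"
proof -
  note [measurable] = measurable_copies[OF ijk(1)] measurable_copies[OF ijk(2)]
  have "(\<integral>\<^sup>+\<omega>. ennreal \<bar>X' i \<omega> - X' j \<omega>\<bar> \<partial>M) =
      ennreal s1 * (\<integral>\<^sup>+u. \<integral>\<^sup>+u'. ennreal \<bar>u - u'\<bar> \<partial>std_normal \<partial>std_normal)"
    using nn_integral_copies[of "\<lambda>(p, q, r). ennreal \<bar>fst p - fst q\<bar>"] s1
    by (simp add: abs_diff_T[simplified] ennreal_mult nn_integral_cmult)
  also have "\<dots> = ennreal (2 * s1 / sqrt pi)"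
    using s1 by (simp add: std_normal_abs_diff ennreal_mult[symmetric] mult.commute)
  finally show ?thesis
    using s1 by (simp add: integral_eq_nn_integral)
qed

lemma mean_abs_diff_Y: "(\<integral>\<omega>. \<bar>Y' i \<omega> - Y' j \<omega>\<bar> \<partial>M) = 2 * s2 / sqrt pi"
proof -
  note [measurable] = measurable_copies[OF ijk(1)] measurable_copies[OF ijk(2)]
  \<comment> \<open>Since \<open>\<theta>\<^sup>2 + c\<^sup>2 = 1\<close>, the standardised second variable is again standard normal.\<close>
  have marginal: "(\<integral>\<^sup>+u. \<integral>\<^sup>+v. g (\<theta> * u + c * v) \<partial>std_normal \<partial>std_normal) = (\<integral>\<^sup>+w. g w \<partial>std_normal)"
    if "g \<in> borel_measurable borel" for g
    using std_normal_linear_combination[OF that, of \<theta> c] by (simp add: c)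
  have "(\<integral>\<^sup>+\<omega>. ennreal \<bar>Y' i \<omega> - Y' j \<omega>\<bar> \<partial>M) =
      ennreal s2 * (\<integral>\<^sup>+u. \<integral>\<^sup>+v. \<integral>\<^sup>+u'. \<integral>\<^sup>+v'. ennreal \<bar>(\<theta> * u + c * v) - (\<theta> * u' + c * v')\<bar>
         \<partial>std_normal \<partial>std_normal \<partial>std_normal \<partial>std_normal)"
    using nn_integral_copies[of "\<lambda>(p, q, r). ennreal \<bar>snd p - snd q\<bar>"] s2
    by (simp add: abs_diff_T[simplified] ennreal_mult nn_integral_cmult)
  also have "\<dots> = ennreal s2 * (\<integral>\<^sup>+u. \<integral>\<^sup>+v. \<integral>\<^sup>+w. ennreal \<bar>(\<theta> * u + c * v) - w\<bar> \<partial>std_normal \<partial>std_normal \<partial>std_normal)"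
  proof -
    have "(\<integral>\<^sup>+u'. \<integral>\<^sup>+v'. ennreal \<bar>y - (\<theta> * u' + c * v')\<bar> \<partial>std_normal \<partial>std_normal) =
        (\<integral>\<^sup>+w. ennreal \<bar>y - w\<bar> \<partial>std_normal)" for y
      using marginal[of "\<lambda>w. ennreal \<bar>y - w\<bar>"] by simp
    then show ?thesis by (simp only:)
  qed
  also have "\<dots> = ennreal s2 * (\<integral>\<^sup>+u. \<integral>\<^sup>+w. ennreal \<bar>u - w\<bar> \<partial>std_normal \<partial>std_normal)"
    using marginal[of "\<lambda>u. \<integral>\<^sup>+w. ennreal \<bar>u - w\<bar> \<partial>std_normal"] by simp
  also have "\<dots> = ennreal (2 * s2 / sqrt pi)"
    using s2 by (simp add: std_normal_abs_diff ennreal_mult[symmetric] mult.commute)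
  finally show ?thesis
    using s2 by (simp add: integral_eq_nn_integral)
qed

lemma mean_product_two_copies:
  "(\<integral>\<omega>. \<bar>X' i \<omega> - X' j \<omega>\<bar> * \<bar>Y' i \<omega> - Y' j \<omega>\<bar> \<partial>M) =
     4 * s1 * s2 / pi * (\<theta> * arcsin \<theta> + sqrt (1 - \<theta>\<^sup>2))"
proof -
  note [measurable] = measurable_copies[OF ijk(1)] measurable_copies[OF ijk(2)]
  have split: "ennreal (s1 * x * (s2 * y)) = ennreal (s1 * s2) * ennreal (x * y)" for x y
    using s1 s2 by (simp add: ennreal_mult'[symmetric] mult_ac)
  have "(\<integral>\<^sup>+\<omega>. ennreal (\<bar>X' i \<omega> - X' j \<omega>\<bar> * \<bar>Y' i \<omega> - Y' j \<omega>\<bar>) \<partial>M) =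
     (\<integral>\<^sup>+u1. \<integral>\<^sup>+v1. \<integral>\<^sup>+u2. \<integral>\<^sup>+v2. ennreal (s1 * \<bar>u1 - u2\<bar> * (s2 * \<bar>(\<theta> * u1 + c * v1) - (\<theta> * u2 + c * v2)\<bar>))
      \<partial>std_normal \<partial>std_normal \<partial>std_normal \<partial>std_normal)"
    using nn_integral_copies[of "\<lambda>(p, q, r). ennreal (\<bar>fst p - fst q\<bar> * \<bar>snd p - snd q\<bar>)"]
    by (simp add: abs_diff_T[simplified])
  also have "\<dots> = ennreal (s1 * s2) * ennreal (4 / pi * (\<theta> * arcsin \<theta> + c))"
    unfolding split std_normal_diffs_two_copies[OF \<theta>, folded c_def, symmetric]
    by (simp add: nn_integral_cmult)
  also have "\<dots> = ennreal (4 * s1 * s2 / pi * (\<theta> * arcsin \<theta> + c))"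
    using s1 s2 by (simp add: ennreal_mult'[symmetric] mult_ac)
  finally have "(\<integral>\<omega>. \<bar>X' i \<omega> - X' j \<omega>\<bar> * \<bar>Y' i \<omega> - Y' j \<omega>\<bar> \<partial>M) = enn2real \<dots>"
    by (simp add: integral_eq_nn_integral)
  also have "\<dots> = 4 * s1 * s2 / pi * (\<theta> * arcsin \<theta> + c)"
    using s1 s2 c(1) arcsin_times_self_nonneg[of \<theta>] \<theta> by (intro enn2real_ennreal) simp
  finally show ?thesis
    by (simp add: c_def)
qed

lemma mean_product_three_copies:
  "(\<integral>\<omega>. \<bar>X' i \<omega> - X' j \<omega>\<bar> * \<bar>Y' i \<omega> - Y' k \<omega>\<bar> \<partial>M) =
     2 * s1 * s2 / pi * (\<theta> * arcsin (\<theta> / 2) + sqrt (4 - \<theta>\<^sup>2))"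
proof -
  note [measurable] = measurable_copies[OF ijk(1)] measurable_copies[OF ijk(2)] measurable_copies[OF ijk(3)]
  have split: "ennreal (s1 * x * (s2 * y)) = ennreal (s1 * s2) * ennreal (x * y)" for x y
    using s1 s2 by (simp add: ennreal_mult'[symmetric] mult_ac)
  have "(\<integral>\<^sup>+\<omega>. ennreal (\<bar>X' i \<omega> - X' j \<omega>\<bar> * \<bar>Y' i \<omega> - Y' k \<omega>\<bar>) \<partial>M) =
     (\<integral>\<^sup>+u1. \<integral>\<^sup>+v1. \<integral>\<^sup>+u2. \<integral>\<^sup>+u3. \<integral>\<^sup>+v3. ennreal (s1 * \<bar>u1 - u2\<bar> * (s2 * \<bar>(\<theta> * u1 + c * v1) - (\<theta> * u3 + c * v3)\<bar>))
      \<partial>std_normal \<partial>std_normal \<partial>std_normal \<partial>std_normal \<partial>std_normal)"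
    using nn_integral_copies[of "\<lambda>(p, q, r). ennreal (\<bar>fst p - fst q\<bar> * \<bar>snd p - snd r\<bar>)"]
    by (simp add: abs_diff_T[simplified])
  also have "\<dots> = ennreal (s1 * s2) * ennreal (2 / pi * (\<theta> * arcsin (\<theta> / 2) + sqrt (4 - \<theta>\<^sup>2)))"
    unfolding split std_normal_diffs_three_copies[OF \<theta>, folded c_def, symmetric]
    by (simp add: nn_integral_cmult)
  also have "\<dots> = ennreal (2 * s1 * s2 / pi * (\<theta> * arcsin (\<theta> / 2) + sqrt (4 - \<theta>\<^sup>2)))"
    using s1 s2 by (simp add: ennreal_mult'[symmetric] mult_ac)
  finally have "(\<integral>\<omega>. \<bar>X' i \<omega> - X' j \<omega>\<bar> * \<bar>Y' i \<omega> - Y' k \<omega>\<bar> \<partial>M) = enn2real \<dots>"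
    by (simp add: integral_eq_nn_integral)
  also have "\<dots> = 2 * s1 * s2 / pi * (\<theta> * arcsin (\<theta> / 2) + sqrt (4 - \<theta>\<^sup>2))"
  proof (rule enn2real_ennreal)
    have "0 \<le> \<theta> * arcsin (\<theta> / 2)"
      using arcsin_times_self_nonneg[of "\<theta> / 2"] \<theta> by simp
    then show "0 \<le> 2 * s1 * s2 / pi * (\<theta> * arcsin (\<theta> / 2) + sqrt (4 - \<theta>\<^sup>2))"
      using s1 s2 \<theta>2 by simp
  qed
  finally show ?thesis .
qed

end

section \<open>Bergsma's covariance of the bivariate normal law\<close>

theorem lemma3:
  fixes m1 m2 \<sigma>1 \<sigma>2 \<theta> :: real
    and N :: "'a measure" and X Y :: "'a \<Rightarrow> real"
    and M :: "'b measure" and X' Y' :: "nat \<Rightarrow> 'b \<Rightarrow> real"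
  assumes "\<sigma>1 > 0" and "\<sigma>2 > 0" and "-1 < \<theta>" and "\<theta> < 1"
    and "prob_space N" and "prob_space M"
    and "bivariate_normal N X Y m1 m2 \<sigma>1 \<sigma>2 \<theta>"
    and "iid_copies N X Y M X' Y' {1, 2, 3}"
  shows
    "let \<mu>1 = (\<integral>\<omega>. \<bar>X' 1 \<omega> - X' 2 \<omega>\<bar> \<partial>M);
         \<mu>2 = (\<integral>\<omega>. \<bar>Y' 1 \<omega> - Y' 2 \<omega>\<bar> \<partial>M);
         \<mu>3 = (\<integral>\<omega>. \<bar>X' 1 \<omega> - X' 2 \<omega>\<bar> * \<bar>Y' 1 \<omega> - Y' 3 \<omega>\<bar> \<partial>M);
         \<mu>12 = (\<integral>\<omega>. \<bar>X' 1 \<omega> - X' 2 \<omega>\<bar> * \<bar>Y' 1 \<omega> - Y' 2 \<omega>\<bar> \<partial>M);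
         \<kappa> = bergsma_cov N X Y
     in \<mu>1 = 2 * \<sigma>1 / sqrt pi \<and>
        \<mu>2 = 2 * \<sigma>2 / sqrt pi \<and>
        \<mu>3 = \<sigma>1 * \<sigma>2 * (2 / pi * sqrt (1 / (4 - \<theta>\<^sup>2)) + 2 * \<theta> / pi * arcsin (\<theta> / 2)
               + 2 * (3 - \<theta>\<^sup>2) / (pi * sqrt (4 - \<theta>\<^sup>2))) \<and>
        \<mu>12 = 4 * \<sigma>1 * \<sigma>2 / pi * (\<theta> * arcsin \<theta> + sqrt (1 - \<theta>\<^sup>2)) \<and>
        \<kappa> = 1 / 4 * (\<mu>12 + \<mu>1 * \<mu>2 - 2 * \<mu>3) \<and>
        \<kappa> = \<sigma>1 * \<sigma>2 / pi * (\<theta> * arcsin \<theta> + sqrt (1 - \<theta>\<^sup>2) + 1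
              - \<theta> * arcsin (\<theta> / 2) - sqrt (4 - \<theta>\<^sup>2))"
proof -
  have \<theta>: "\<bar>\<theta>\<bar> < 1"
    using assms(3,4) by linarith
  interpret bivariate_normal_copies N X Y m1 m2 \<sigma>1 \<sigma>2 \<theta> M X' Y' "{1, 2, 3}" 1 2 3
    by (intro bivariate_normal_copies.intro bivariate_normal_pair.intro
        bivariate_normal_copies_axioms.intro assms \<theta>) simp_all
  define w where "w = sqrt (4 - \<theta>\<^sup>2)"
  have w: "0 < w" "w * w = 4 - \<theta>\<^sup>2"
    using \<theta>2 by (simp_all add: w_def)
  \<comment> \<open>The first and third summands of the stated mixed moment combine to \<open>2 / \<pi> sqrt (4 - \<theta>\<^sup>2)\<close>.\<close>
  have "2 / pi * sqrt (1 / (4 - \<theta>\<^sup>2)) + 2 * (3 - \<theta>\<^sup>2) / (pi * w) = 2 * (4 - \<theta>\<^sup>2) / (pi * w)"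
    using w(1) by (simp add: real_sqrt_divide w_def[symmetric] add_divide_distrib[symmetric])
  also have "\<dots> = 2 / pi * w"
    unfolding w(2)[symmetric] using w(1) by simp
  finally have "\<sigma>1 * \<sigma>2 * (2 / pi * sqrt (1 / (4 - \<theta>\<^sup>2)) + 2 * \<theta> / pi * arcsin (\<theta> / 2)
               + 2 * (3 - \<theta>\<^sup>2) / (pi * w)) = 2 * \<sigma>1 * \<sigma>2 / pi * (\<theta> * arcsin (\<theta> / 2) + w)"
    by (simp add: algebra_simps)
  then have \<mu>3: "2 * \<sigma>1 * \<sigma>2 / pi * (\<theta> * arcsin (\<theta> / 2) + sqrt (4 - \<theta>\<^sup>2)) =
     \<sigma>1 * \<sigma>2 * (2 / pi * sqrt (1 / (4 - \<theta>\<^sup>2)) + 2 * \<theta> / pi * arcsin (\<theta> / 2)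
               + 2 * (3 - \<theta>\<^sup>2) / (pi * sqrt (4 - \<theta>\<^sup>2)))"
    unfolding w_def by simp
  note \<kappa> = bergsma_cov_iid_copies[OF prob_N prob_M square_integrable_X square_integrable_Y copies ijk]
  have closed_form: "bergsma_cov N X Y = \<sigma>1 * \<sigma>2 / pi * (\<theta> * arcsin \<theta> + sqrt (1 - \<theta>\<^sup>2) + 1
              - \<theta> * arcsin (\<theta> / 2) - sqrt (4 - \<theta>\<^sup>2))"
    unfolding \<kappa> mean_abs_diff_X mean_abs_diff_Y mean_product_two_copies mean_product_three_copies
    by (simp add: field_simps)
  show ?thesis
    unfolding Let_def
    by (intro conjI mean_abs_diff_X mean_abs_diff_Y mean_product_two_copies trans[OF mean_product_three_copies \<mu>3]
        \<kappa> closed_form)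
qed

end
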